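(* In the perturbative BF theory in $\mathbb{R}^3$ (see context), the whole set of the vacuum-to-vacuum connected diagrams for the quantum field components, i.e. the logarithm of $$\frac{\int D(\text{fields})\,e^{i\widetilde S}}{\int D(\text{fields})\,e^{iS_{TOT}}},$$ is equal to the set $iW_1[K]$ of one-loop connected diagrams, which depend only on $K$, and which are given by $$e^{iW_1[K]}=\Big\langle \exp\Big(-i\int d^3x\,\epsilon^{abc}\big\{\epsilon^{\mu\nu\lambda}B^a_\mu\widehat A^b_\nu A^c_\lambda+\partial^\mu\overline c^a\,\widehat A^b_\mu c^c+\partial^\mu\overline\xi^a\,\widehat A^b_\mu\xi^c\big\}\Big)\Big\rangle ,$$ where $\langle\cdot\rangle$ is the expectation value with respect to $S_{TOT}$.
   Context: Colour indices $a,b,c\in\{1,2,3\}$ and Euclidean vector indices $\mu,\nu,\lambda\in\{1,2,3\}$ are summed when repeated. Bosonic fields on $\mathbb{R}^3$: $A^a_\mu,B^a_\mu,M^a,N^a$; anticommuting ghosts $c^a,\xi^a$ and antighosts $\overline c^a,\overline\xi^a$; $g$ real. $F^a_{\mu\nu}(A)=\partial_\mu A^a_\nu-\partial_\nu A^a_\mu-\epsilon^{abc}A^b_\mu A^c_\nu$. The total action is $S_{TOT}=S+S_{\phi\pi}$ with $$S[A,B]=\int d^3x\,\epsilon^{\mu\nu\lambda}\Big\{\tfrac12B^a_\mu F^a_{\nu\lambda}(A)+g\big[\tfrac12A^a_\mu\partial_\nu A^a_\lambda-\tfrac16\epsilon^{abc}A^a_\mu A^b_\nu A^c_\lambda\big]\Big\},$$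 $$S_{\phi\pi}=\int d^3x\Big\{M^a\partial^\mu A^a_\mu+N^a\partial^\mu B^a_\mu+\partial^\mu\overline c^a(\partial_\mu c^a-\epsilon^{abc}A^b_\mu c^c)+\partial^\mu\overline\xi^a(\partial_\mu\xi^a-\epsilon^{abc}A^b_\mu\xi^c-\epsilon^{abc}B^b_\mu c^c)\Big\}.$$ Perturbation theory: Wick contractions with the propagators of the quadratic part of $S_{TOT}$. The nonvanishing ones, with $\Delta(x)=\int\frac{d^3k}{(2\pi)^3}\frac{e^{ikx}}{k^2}$ and a contraction written $\overline{\phi\,\psi}$, are $\overline{A^a_\mu(x)B^b_\nu(y)}=-i\delta^{ab}\epsilon_{\mu\nu\lambda}\partial^\lambda\Delta(x-y)$, $\overline{B^a_\mu(x)B^b_\nu(y)}=ig\,\delta^{ab}\epsilon_{\mu\nu\lambda}\partial^\lambda\Delta(x-y)$, $\overline{A^a_\mu(x)M^b(y)}=\overline{B^a_\mu(x)N^b(y)}=-i\delta^{ab}\partial_\mu\Delta(x-y)$, $\overline{c^a(x)\overline c^b(y)}=\overline{\xi^a(x)\overline\xi^b(y)}=i\delta^{ab}\Delta(x-y)$. The expectation value of $X$ is the formal perturbative series of $\langle X\rangle=\int D(\text{fields})e^{iS_{TOT}}X\big/\int D(\text{fields})e^{iS_{TOT}}$. The statement concerns the combinatorial structure of diagrams, prior to renormalization. Given sources $J^a_\mu,K^a_\mu$, let $\widehat A^a_\mu,\widehat B^a_\mu$ be the classical fields, determined perturbatively in the sources, which satisfy $\frac{\delta S[\widehat A,\widehat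 B]}{\delta\widehat B^a_\mu}+K^a_\mu=0$, $\frac{\delta S[\widehat A,\widehat B]}{\delta\widehat A^a_\mu}+J^a_\mu=0$, $\partial^\mu\widehat A^a_\mu=0=\partial^\mu\widehat B^a_\mu$ (the field $\widehat A$ depends only on $K$). Shifting $A\to A+\widehat A$, $B\to B+\widehat B$ in the path integral for the generating functional $W[J,K]$ (with source term $\int(J^a_\mu A^a_\mu+K^a_\mu B^a_\mu)$) leads to the action for the quantum components $$\widetilde S=S_{TOT}-\int d^3x\,\epsilon^{\mu\nu\lambda}\epsilon^{abc}\big[B^a_\mu\widehat A^b_\nu A^c_\lambda+\tfrac12\widehat B^a_\mu A^b_\nu A^c_\lambda+\tfrac12g\,A^a_\mu\widehat A^b_\nu A^c_\lambda\big]-\int d^3x\,\epsilon^{abc}\big[\partial^\mu\overline c^a\widehat A^b_\mu c^c+\partial^\mu\overline\xi^a\widehat A^b_\mu\xi^c+\partial^\mu\overline\xi^a\widehat B^b_\mu c^c\big].$$ The vacuum-to-vacuum connected diagrams for the quantum field components are the connected diagrams of $\int D(\text{fields})e^{i\widetilde S}\big/\int D(\text{fields})e^{iS_{TOT}}$. *)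

theory Defs
  imports "HOL-Analysis.Analysis" "HOL-Computational_Algebra.Formal_Power_Series"
    "HOL-Library.Function_Algebras"
begin

section \<open>Fields and Lagrangian densities\<close>

text \<open>The type \<open>3\<close> serves both as colour index and as vector index; its elements are
  \<open>1\<close>, \<open>2\<close> and \<open>3 = 0\<close>.\<close>

type_synonym pt = "real^3"

definition eps :: "3 \<Rightarrow> 3 \<Rightarrow> 3 \<Rightarrow> real" where
  "eps i j k =
     (if (i, j, k) \<in> {(1, 2, 3), (2, 3, 1), (3, 1, 2)} then 1
      else if (i, j, k) \<in> {(3, 2, 1), (1, 3, 2), (2, 1, 3)} then - 1 else 0)"

definition kron :: "3 \<Rightarrow> 3 \<Rightarrow> real" where
  "kron a b = (if a = b then 1 else 0)"

datatype field =
    FA 3 3 | FB 3 3 | FM 3 | FN 3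
  | FC 3 | FCbar 3 | FXi 3 | FXibar 3

fun ghost :: "field \<Rightarrow> bool" where
  "ghost (FC a) = True" | "ghost (FCbar a) = True"
| "ghost (FXi a) = True" | "ghost (FXibar a) = True"
| "ghost _ = False"

text \<open>\<open>Jet [\<mu>1, \<dots>, \<mu>k] \<phi>\<close> stands for the iterated partial derivative of the field \<open>\<phi>\<close>.\<close>

datatype jet = Jet (derivs: "3 list") (fld: field)

text \<open>A density is a polynomial in noncommuting jet symbols, given by the coefficient of
  each word; the order of the symbols in a word matters because of the ghosts. Coefficients are
  functions on space with values in the power series in a variable \<open>t\<close> that counts the
  order in the classical sources. Addition, subtraction and finite sums of densities are the
  pointwise ones.\<close>

type_synonym density = "jet list \<Rightarrow> pt \<Rightarrow> real fps"

definition qf :: "field \<Rightarrow> density" where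
  "qf \<phi> = (\<lambda>w x. if w = [Jet [] \<phi>] then 1 else 0)"

definition dqf :: "3 \<Rightarrow> field \<Rightarrow> density" where
  "dqf \<mu> \<phi> = (\<lambda>w x. if w = [Jet [\<mu>] \<phi>] then 1 else 0)"

text \<open>A classical background function, as a density without quantum fields.\<close>

definition bg :: "(pt \<Rightarrow> real fps) \<Rightarrow> density" where
  "bg f = (\<lambda>w x. if w = [] then f x else 0)"

definition dscale :: "real \<Rightarrow> density \<Rightarrow> density"  (infixr \<open>\<odot>\<close> 72) where
  "r \<odot> p = (\<lambda>w x. fps_const r * p w x)"

definition dmul :: "density \<Rightarrow> density \<Rightarrow> density"  (infixl \<open>\<star>\<close> 75) where
  "p \<star> q = (\<lambda>w x. \<Sum>k\<le>length w. p (take k w) x * q (drop k w) x)"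


section \<open>The actions\<close>

definition curvature :: "3 \<Rightarrow> 3 \<Rightarrow> 3 \<Rightarrow> density" where
  "curvature a \<mu> \<nu> = dqf \<mu> (FA a \<nu>) - dqf \<nu> (FA a \<mu>)
     - (\<Sum>b\<in>UNIV. \<Sum>c\<in>UNIV. eps a b c \<odot> qf (FA b \<mu>) \<star> qf (FA c \<nu>))"

definition L_S :: "real \<Rightarrow> density" where
  "L_S g = (\<Sum>\<mu>\<in>UNIV. \<Sum>\<nu>\<in>UNIV. \<Sum>l\<in>UNIV. eps \<mu> \<nu> l \<odot>
     ((\<Sum>a\<in>UNIV. (1/2) \<odot> qf (FB a \<mu>) \<star> curvature a \<nu> l)
      + g \<odot> ((\<Sum>a\<in>UNIV. (1/2) \<odot> qf (FA a \<mu>) \<star> dqf \<nu> (FA a l))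
              - (\<Sum>a\<in>UNIV. \<Sum>b\<in>UNIV. \<Sum>c\<in>UNIV.
                   (1/6 * eps a b c) \<odot> qf (FA a \<mu>) \<star> qf (FA b \<nu>) \<star> qf (FA c l)))))"

definition L_gauge_fixing :: density where
  "L_gauge_fixing = (\<Sum>\<mu>\<in>UNIV. \<Sum>a\<in>UNIV.
       qf (FM a) \<star> dqf \<mu> (FA a \<mu>) + qf (FN a) \<star> dqf \<mu> (FB a \<mu>)
     + dqf \<mu> (FCbar a) \<star>
         (dqf \<mu> (FC a) - (\<Sum>b\<in>UNIV. \<Sum>c\<in>UNIV. eps a b c \<odot> qf (FA b \<mu>) \<star> qf (FC c)))
     + dqf \<mu> (FXibar a) \<star>
         (dqf \<mu> (FXi a) - (\<Sum>b\<in>UNIV. \<Sum>c\<in>UNIV. eps a b c \<odot> qf (FA b \<mu>) \<star> qf (FXi c))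
          - (\<Sum>b\<in>UNIV. \<Sum>c\<in>UNIV. eps a b c \<odot> qf (FB b \<mu>) \<star> qf (FC c))))"

definition L_TOT :: "real \<Rightarrow> density" where
  "L_TOT g = L_S g + L_gauge_fixing"

definition L_free :: "real \<Rightarrow> density" where
  "L_free g = (\<lambda>w. if length w = 2 then L_TOT g w else 0)"

type_synonym classical = "3 \<Rightarrow> 3 \<Rightarrow> pt \<Rightarrow> real fps"

definition L_tilde :: "real \<Rightarrow> classical \<Rightarrow> classical \<Rightarrow> density" where
  "L_tilde g Ah Bh = L_TOT g
     - (\<Sum>\<mu>\<in>UNIV. \<Sum>\<nu>\<in>UNIV. \<Sum>l\<in>UNIV. \<Sum>a\<in>UNIV. \<Sum>b\<in>UNIV. \<Sum>c\<in>UNIV.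
          (eps \<mu> \<nu> l * eps a b c) \<odot>
            (qf (FB a \<mu>) \<star> bg (Ah b \<nu>) \<star> qf (FA c l)
             + (1/2) \<odot> bg (Bh a \<mu>) \<star> qf (FA b \<nu>) \<star> qf (FA c l)
             + (g/2) \<odot> qf (FA a \<mu>) \<star> bg (Ah b \<nu>) \<star> qf (FA c l)))
     - (\<Sum>\<mu>\<in>UNIV. \<Sum>a\<in>UNIV. \<Sum>b\<in>UNIV. \<Sum>c\<in>UNIV. eps a b c \<odot>
          (dqf \<mu> (FCbar a) \<star> bg (Ah b \<mu>) \<star> qf (FC c)
           + dqf \<mu> (FXibar a) \<star> bg (Ah b \<mu>) \<star> qf (FXi c)
           + dqf \<mu> (FXibar a) \<star> bg (Bh b \<mu>) \<star> qf (FC c)))"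

text \<open>The functional whose exponential is averaged to give \<open>exp (i W1)\<close>.\<close>

definition L_one_loop :: "classical \<Rightarrow> density" where
  "L_one_loop Ah = - (\<Sum>a\<in>UNIV. \<Sum>b\<in>UNIV. \<Sum>c\<in>UNIV. eps a b c \<odot>
      ((\<Sum>\<mu>\<in>UNIV. \<Sum>\<nu>\<in>UNIV. \<Sum>l\<in>UNIV.
          eps \<mu> \<nu> l \<odot> qf (FB a \<mu>) \<star> bg (Ah b \<nu>) \<star> qf (FA c l))
       + (\<Sum>\<mu>\<in>UNIV. dqf \<mu> (FCbar a) \<star> bg (Ah b \<mu>) \<star> qf (FC c))
       + (\<Sum>\<mu>\<in>UNIV. dqf \<mu> (FXibar a) \<star> bg (Ah b \<mu>) \<star> qf (FXi c))))"


section \<open>Partial derivatives, functional derivatives and the classical fields\<close>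

definition pd :: "3 \<Rightarrow> (pt \<Rightarrow> 'a::real_normed_vector) \<Rightarrow> pt \<Rightarrow> 'a" where
  "pd \<mu> f x = vector_derivative (\<lambda>s. f (x + s *\<^sub>R axis \<mu> 1)) (at 0)"

definition fpd :: "3 \<Rightarrow> (pt \<Rightarrow> real fps) \<Rightarrow> pt \<Rightarrow> real fps" where
  "fpd \<mu> F x = Abs_fps (\<lambda>k. pd \<mu> (\<lambda>y. fps_nth (F y) k) x)"

fun classical_config :: "classical \<Rightarrow> classical \<Rightarrow> jet \<Rightarrow> pt \<Rightarrow> real fps" where
  "classical_config Ah Bh (Jet \<alpha> (FA a \<mu>)) = foldr fpd \<alpha> (Ah a \<mu>)"
| "classical_config Ah Bh (Jet \<alpha> (FB a \<mu>)) = foldr fpd \<alpha> (Bh a \<mu>)"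
| "classical_config Ah Bh (Jet \<alpha> _) = (\<lambda>x. 0)"

text \<open>Partial derivative of a bosonic density with respect to the jet variable \<open>j\<close>, evaluated
  on a classical configuration.\<close>

definition jet_derivative :: "density \<Rightarrow> (jet \<Rightarrow> pt \<Rightarrow> real fps) \<Rightarrow> jet \<Rightarrow> pt \<Rightarrow> real fps" where
  "jet_derivative p u j x = (\<Sum>w | p w \<noteq> 0. p w x *
     (\<Sum>i | i < length w \<and> w ! i = j. \<Prod>k\<in>{..<length w} - {i}. u (w ! k) x))"

text \<open>Functional derivative of the integral of a density of first order in derivatives with
  respect to a bosonic field \<open>\<phi>\<close>.\<close>

definition functional_derivative ::
    "density \<Rightarrow> (jet \<Rightarrow> pt \<Rightarrow> real fps) \<Rightarrow> field \<Rightarrow> pt \<Rightarrow> real fps" where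
  "functional_derivative p u \<phi> x =
     jet_derivative p u (Jet [] \<phi>) x - (\<Sum>\<mu>\<in>UNIV. fpd \<mu> (jet_derivative p u (Jet [\<mu>] \<phi>)) x)"

text \<open>Fields that are built perturbatively from the sources have no term of order zero in \<open>t\<close>.
  Each order is a twice differentiable function that vanishes at infinity (the boundary condition
  satisfied by the Green function of the propagators).\<close>

definition perturbative_field :: "(pt \<Rightarrow> real fps) \<Rightarrow> bool" where
  "perturbative_field F \<longleftrightarrow>
     (\<forall>x. fps_nth (F x) 0 = 0) \<and>
     (\<forall>k \<alpha>. length \<alpha> \<le> 1 \<longrightarrow> foldr pd \<alpha> (\<lambda>x. fps_nth (F x) k) differentiable_on UNIV) \<and>
     (\<forall>k. ((\<lambda>x. fps_nth (F x) k) \<longlongrightarrow> 0) at_infinity)"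

text \<open>The sources may be arbitrary power series in \<open>t\<close>. An ordinary source \<open>K\<^sub>0\<close> is
  the case \<open>K = fps_X * fps_const K\<^sub>0\<close>; higher orders are allowed because the equations
  impose a covariant conservation law on \<open>K\<close>, which mixes orders.\<close>

definition classical_fields ::
    "real \<Rightarrow> classical \<Rightarrow> classical \<Rightarrow> classical \<Rightarrow> classical \<Rightarrow> bool" where
  "classical_fields g J K Ah Bh \<longleftrightarrow>
     (\<forall>a \<mu>. perturbative_field (Ah a \<mu>) \<and> perturbative_field (Bh a \<mu>)) \<and>
     (\<forall>a \<mu> x. functional_derivative (L_S g) (classical_config Ah Bh) (FB a \<mu>) x + K a \<mu> x = 0) \<and>
     (\<forall>a \<mu> x. functional_derivative (L_S g) (classical_config Ah Bh) (FA a \<mu>) x + J a \<mu> x = 0) \<and>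
     (\<forall>a x. (\<Sum>\<mu>\<in>UNIV. fpd \<mu> (Ah a \<mu>) x) = 0) \<and>
     (\<forall>a x. (\<Sum>\<mu>\<in>UNIV. fpd \<mu> (Bh a \<mu>) x) = 0)"


section \<open>Propagators\<close>

text \<open>The Fourier integral is not absolutely convergent; it is the limit of spherical cutoffs,
  which exists for \<open>x \<noteq> 0\<close>. At \<open>x = 0\<close> the value is unspecified.\<close>

definition Delta :: "pt \<Rightarrow> complex" where
  "Delta x = Lim at_top (\<lambda>R::real. integral (cball 0 R)
     (\<lambda>k::pt. exp (\<i> * of_real (k \<bullet> x)) / of_real (norm k ^ 2)) / of_real ((2 * pi) ^ 3))"

definition prop_AB :: "3 \<Rightarrow> 3 \<Rightarrow> 3 \<Rightarrow> 3 \<Rightarrow> pt \<Rightarrow> complex" where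
  "prop_AB a \<mu> b \<nu> z = - \<i> * of_real (kron a b) * (\<Sum>l\<in>UNIV. of_real (eps \<mu> \<nu> l) * pd l Delta z)"

definition prop_BB :: "real \<Rightarrow> 3 \<Rightarrow> 3 \<Rightarrow> 3 \<Rightarrow> 3 \<Rightarrow> pt \<Rightarrow> complex" where
  "prop_BB g a \<mu> b \<nu> z =
     \<i> * of_real (g * kron a b) * (\<Sum>l\<in>UNIV. of_real (eps \<mu> \<nu> l) * pd l Delta z)"

definition prop_AM :: "3 \<Rightarrow> 3 \<Rightarrow> 3 \<Rightarrow> pt \<Rightarrow> complex" where
  "prop_AM a \<mu> b z = - \<i> * of_real (kron a b) * pd \<mu> Delta z"

definition prop_ghost :: "3 \<Rightarrow> 3 \<Rightarrow> pt \<Rightarrow> complex" where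
  "prop_ghost a b z = \<i> * of_real (kron a b) * Delta z"

text \<open>Contraction of \<open>\<phi>(x)\<close> with \<open>\<psi>(y)\<close>, in both orders: symmetric for bosons,
  antisymmetric for ghosts.\<close>

fun propagator :: "real \<Rightarrow> field \<Rightarrow> field \<Rightarrow> pt \<Rightarrow> pt \<Rightarrow> complex" where
  "propagator g (FA a \<mu>) (FB b \<nu>) x y = prop_AB a \<mu> b \<nu> (x - y)"
| "propagator g (FB b \<nu>) (FA a \<mu>) x y = prop_AB a \<mu> b \<nu> (y - x)"
| "propagator g (FB a \<mu>) (FB b \<nu>) x y = prop_BB g a \<mu> b \<nu> (x - y)"
| "propagator g (FA a \<mu>) (FM b) x y = prop_AM a \<mu> b (x - y)"
| "propagator g (FM b) (FA a \<mu>) x y = prop_AM a \<mu> b (y - x)"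
| "propagator g (FB a \<mu>) (FN b) x y = prop_AM a \<mu> b (x - y)"
| "propagator g (FN b) (FB a \<mu>) x y = prop_AM a \<mu> b (y - x)"
| "propagator g (FC a) (FCbar b) x y = prop_ghost a b (x - y)"
| "propagator g (FCbar b) (FC a) x y = - prop_ghost a b (y - x)"
| "propagator g (FXi a) (FXibar b) x y = prop_ghost a b (x - y)"
| "propagator g (FXibar b) (FXi a) x y = - prop_ghost a b (y - x)"
| "propagator g _ _ x y = 0"

fun contractible :: "field \<Rightarrow> field \<Rightarrow> bool" where
  "contractible (FA a \<mu>) (FB b \<nu>) = True"
| "contractible (FB b \<nu>) (FA a \<mu>) = True"
| "contractible (FB a \<mu>) (FB b \<nu>) = True"
| "contractible (FA a \<mu>) (FM b) = True"
| "contractible (FM b) (FA a \<mu>) = True"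
| "contractible (FB a \<mu>) (FN b) = True"
| "contractible (FN b) (FB a \<mu>) = True"
| "contractible (FC a) (FCbar b) = True"
| "contractible (FCbar b) (FC a) = True"
| "contractible (FXi a) (FXibar b) = True"
| "contractible (FXibar b) (FXi a) = True"
| "contractible _ _ = False"

definition contraction :: "real \<Rightarrow> jet \<Rightarrow> jet \<Rightarrow> pt \<Rightarrow> pt \<Rightarrow> complex" where
  "contraction g p q x y =
     foldr pd (derivs p) (\<lambda>x'. foldr pd (derivs q) (\<lambda>y'. propagator g (fld p) (fld q) x' y') y) x"


section \<open>Diagrams\<close>

text \<open>A diagram with \<open>n\<close> labelled vertices is a list of \<open>n\<close> words (the monomials of the
  interaction placed at the vertices) with a complete set of Wick contractions. The leg \<open>(v, i)\<close>
  is the \<open>i\<close>-th factor at vertex \<open>v\<close>; a contraction is a pair of legs in the order in which they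
  occur in the product of all the words.\<close>

type_synonym leg = "nat \<times> nat"
type_synonym diagram = "jet list list \<times> (leg \<times> leg) set"

definition legs :: "jet list list \<Rightarrow> leg set" where
  "legs ws = {(v, i). v < length ws \<and> i < length (ws ! v)}"

definition jet_at :: "jet list list \<Rightarrow> leg \<Rightarrow> jet" where
  "jet_at ws l = ws ! fst l ! snd l"

definition leg_less :: "leg \<Rightarrow> leg \<Rightarrow> bool" where
  "leg_less l m \<longleftrightarrow> fst l < fst m \<or> fst l = fst m \<and> snd l < snd m"

definition complete_contraction :: "jet list list \<Rightarrow> (leg \<times> leg) set \<Rightarrow> bool" where
  "complete_contraction ws P \<longleftrightarrow>
     P \<subseteq> legs ws \<times> legs ws \<and>
     (\<forall>(l, m)\<in>P. leg_less l m \<and> contractible (fld (jet_at ws l)) (fld (jet_at ws m))) \<and>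
     (\<forall>l\<in>legs ws. \<exists>!e. e \<in> P \<and> (l = fst e \<or> l = snd e))"

definition diagrams :: "density \<Rightarrow> nat \<Rightarrow> diagram set" where
  "diagrams L n = {(ws, P). length ws = n \<and> (\<forall>w\<in>set ws. L w \<noteq> 0) \<and> complete_contraction ws P}"

definition adjacent :: "diagram \<Rightarrow> (nat \<times> nat) set" where
  "adjacent D = {(v, w). \<exists>(l, m)\<in>snd D. (fst l = v \<and> fst m = w) \<or> (fst l = w \<and> fst m = v)}"

definition connected_diagram :: "diagram \<Rightarrow> bool" where
  "connected_diagram D \<longleftrightarrow> fst D \<noteq> [] \<and>
     (\<forall>v<length (fst D). \<forall>w<length (fst D). (v, w) \<in> (adjacent D)\<^sup>*)"

definition connected_diagrams :: "density \<Rightarrow> nat \<Rightarrow> diagram set" where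
  "connected_diagrams L n = {D \<in> diagrams L n. connected_diagram D}"

text \<open>First Betti number of a connected diagram.\<close>

definition loop_number :: "diagram \<Rightarrow> int" where
  "loop_number D = int (card (snd D)) - int (length (fst D)) + 1"

text \<open>The Fermi sign is the parity of the number of crossings of ghost lines.\<close>

definition fermi_sign :: "diagram \<Rightarrow> complex" where
  "fermi_sign D = (- 1) ^ card {(e, f). e \<in> snd D \<and> f \<in> snd D \<and>
     ghost (fld (jet_at (fst D) (fst e))) \<and> ghost (fld (jet_at (fst D) (fst f))) \<and>
     leg_less (fst e) (fst f) \<and> leg_less (fst f) (snd e) \<and> leg_less (snd e) (snd f)}"

definition cplx_fps :: "real fps \<Rightarrow> complex fps" where
  "cplx_fps f = Abs_fps (\<lambda>k. of_real (fps_nth f k))"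

text \<open>The integrand of a diagram with vertex \<open>v\<close> at the point \<open>x v\<close>.\<close>

definition diagram_integrand :: "real \<Rightarrow> density \<Rightarrow> diagram \<Rightarrow> (nat \<Rightarrow> pt) \<Rightarrow> complex fps" where
  "diagram_integrand g L D x =
     (\<Prod>v<length (fst D). cplx_fps (L (fst D ! v) (x v))) *
     fps_const (fermi_sign D *
       (\<Prod>(l, m)\<in>snd D. contraction g (jet_at (fst D) l) (jet_at (fst D) m) (x (fst l)) (x (fst m))))"


section \<open>Formal perturbative series\<close>

text \<open>Prior to renormalization the integrals over the positions of the vertices diverge and have
  only a formal meaning. \<open>I n\<close> stands for the \<open>n\<close>-fold integral, of which only linearity,
  symmetry under relabelling of the integration variables and factorization are postulated.
  Examples are the finite sums of values of the integrand over all \<open>n\<close>-tuples from a finite set of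
  points, with arbitrary weights attached to the points; an identity that holds for every such
  \<open>I\<close> is therefore an identity of symmetrized integrands.\<close>

definition integrand_of :: "nat \<Rightarrow> ((nat \<Rightarrow> pt) \<Rightarrow> complex) \<Rightarrow> bool" where
  "integrand_of n f \<longleftrightarrow> (\<forall>x y. (\<forall>v<n. x v = y v) \<longrightarrow> f x = f y)"

definition formal_integral :: "(nat \<Rightarrow> ((nat \<Rightarrow> pt) \<Rightarrow> complex) \<Rightarrow> complex) \<Rightarrow> bool" where
  "formal_integral I \<longleftrightarrow>
     (\<forall>n f h a b. integrand_of n f \<and> integrand_of n h \<longrightarrow>
        I n (\<lambda>x. a * f x + b * h x) = a * I n f + b * I n h) \<and>
     (\<forall>n f \<pi>. integrand_of n f \<and> \<pi> permutes {..<n} \<longrightarrow> I n (\<lambda>x. f (x \<circ> \<pi>)) = I n f) \<and>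
     (\<forall>m n f h. integrand_of m f \<and> integrand_of n h \<longrightarrow>
        I (m + n) (\<lambda>x. f x * h (\<lambda>v. x (m + v))) = I m f * I n h) \<and>
     I 0 (\<lambda>x. 1) = 1"

definition integrate ::
    "(nat \<Rightarrow> ((nat \<Rightarrow> pt) \<Rightarrow> complex) \<Rightarrow> complex) \<Rightarrow> nat \<Rightarrow> ((nat \<Rightarrow> pt) \<Rightarrow> complex fps) \<Rightarrow> complex fps"
  where "integrate I n F = Abs_fps (\<lambda>k. I n (\<lambda>x. fps_nth (F x) k))"

text \<open>Perturbative series are power series in a variable that counts the vertices, with
  coefficients in the power series in \<open>t\<close>.\<close>

type_synonym pert_series = "complex fps fps"

definition diagram_sum ::
    "(nat \<Rightarrow> ((nat \<Rightarrow> pt) \<Rightarrow> complex) \<Rightarrow> complex) \<Rightarrow> real \<Rightarrow> density \<Rightarrow> (nat \<Rightarrow> diagram set) \<Rightarrow> pert_series"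
  where "diagram_sum I g L DD = Abs_fps (\<lambda>n. fps_const (\<i> ^ n / fact n) *
     integrate I n (\<lambda>x. \<Sum>D\<in>DD n. diagram_integrand g L D x))"

text \<open>The path integral of \<open>exp (i \<integral> L)\<close>, divided by the Gaussian one of the free action: what is
  not in the free action is expanded in vertices and evaluated with Wick's theorem.\<close>

definition path_integral ::
    "(nat \<Rightarrow> ((nat \<Rightarrow> pt) \<Rightarrow> complex) \<Rightarrow> complex) \<Rightarrow> real \<Rightarrow> density \<Rightarrow> pert_series"
  where "path_integral I g L = diagram_sum I g (L - L_free g) (diagrams (L - L_free g))"

text \<open>The expectation value of \<open>exp (i \<integral> X)\<close> with respect to the total action.\<close>

definition expectation_exp ::
    "(nat \<Rightarrow> ((nat \<Rightarrow> pt) \<Rightarrow> complex) \<Rightarrow> complex) \<Rightarrow> real \<Rightarrow> density \<Rightarrow> pert_series"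
  where "expectation_exp I g X = path_integral I g (L_TOT g + X) * inverse (path_integral I g (L_TOT g))"

definition vacuum_ratio ::
    "(nat \<Rightarrow> ((nat \<Rightarrow> pt) \<Rightarrow> complex) \<Rightarrow> complex) \<Rightarrow> real \<Rightarrow> classical \<Rightarrow> classical \<Rightarrow> pert_series"
  where "vacuum_ratio I g Ah Bh =
     path_integral I g (L_tilde g Ah Bh) * inverse (path_integral I g (L_TOT g))"

text \<open>The connected diagrams of the ratio: those of the numerator that do not belong to the
  denominator.\<close>

definition vacuum_connected_diagrams ::
    "real \<Rightarrow> classical \<Rightarrow> classical \<Rightarrow> nat \<Rightarrow> diagram set" where
  "vacuum_connected_diagrams g Ah Bh n =
     connected_diagrams (L_tilde g Ah Bh - L_free g) n - connected_diagrams (L_TOT g - L_free g) n"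

definition pert_exp :: "pert_series \<Rightarrow> pert_series" where
  "pert_exp W = Abs_fps (\<lambda>k. fps_const (fps_nth (fps_exp 1) k)) oo W"

definition pert_ln :: "pert_series \<Rightarrow> pert_series" where
  "pert_ln Z = Abs_fps (\<lambda>k. fps_const (fps_nth (fps_ln 1) k)) oo (Z - 1)"

end

theory Submission
  imports Defs
begin

text \<open>Give the fields the charges A = 1, B = M = -1, c = 2, antighost of c = -2, and 0 otherwise.
  No contraction has positive charge, all vertices have nonnegative charge, and the vertices of
  charge 0 are precisely those of the one-loop functional. Hence only these occur in a complete
  contraction. They have two legs, so that a connected diagram is a single loop. The vacuum
  diagrams of the total action alone are absent, and both ratios of path integrals are the sum over
  all diagrams built from one-loop vertices.

  For the linked cluster theorem, split off the component of vertex 0 from a diagram. Since every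
  vertex carries an even number of ghosts, the Fermi sign is multiplicative under this splitting, and
  the sum Z over all diagrams and the sum W over the connected ones satisfy Z' = W' Z.

  The variation of B turns the field equation into one for the curl of the classical A alone. At each
  order in the source, two solutions differ by a field without curl and divergence that vanishes at
  infinity; its components are harmonic, hence zero by the maximum principle.\<close>


section \<open>Contractions\<close>

text \<open>The size of the charge of \<open>c\<close> comes from the vertex made of an antighost of
  \<open>\<xi>\<close>, a \<open>B\<close> and a \<open>c\<close>: since \<open>B\<close> has charge
  -1 and the antighost of \<open>\<xi>\<close> has charge 0, positivity forces a charge of at least
  2 for \<open>c\<close>. The propagator of \<open>B\<close> with itself has charge -2, so that the
  selection rule is an inequality and not a conservation law. The integrals are formal, so nothing
  can be said about their values: Z and W are comparable only through their integrands, up to the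
  numbering of the vertices. Cutting out a component renumbers the vertices of both pieces, while
  the order of the legs enters the orientation of the lines and the Fermi sign. Hence the pieces are
  embedded by increasing maps, and the permutation of the points is left to the symmetry postulated
  for the integral. Splitting off only the component of one marked vertex, rather than all
  components at once, replaces sums over set partitions by a binomial recursion.\<close>

lemma legs_Sigma: "legs ws = (SIGMA v:{..<length ws}. {..<length (ws ! v)})"
  by (auto simp: legs_def)

lemma sum_legs: "(\<Sum>l\<in>legs ws. f l) = (\<Sum>v<length ws. \<Sum>i<length (ws ! v). f (v, i))"
  by (simp add: legs_Sigma sum.Sigma)

lemma finite_legs [simp]: "finite (legs ws)"
  by (simp add: legs_Sigma)

lemma leg_less_irrefl [simp]: "\<not> leg_less l l"
  by (simp add: leg_less_def)

lemma complete_contraction_line: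
  assumes "complete_contraction ws P" "(l, k) \<in> P"
  shows "l \<in> legs ws" "k \<in> legs ws" "leg_less l k"
    "contractible (fld (jet_at ws l)) (fld (jet_at ws k))"
  using assms unfolding complete_contraction_def by auto

lemma complete_contraction_ex1:
  "complete_contraction ws P \<Longrightarrow> l \<in> legs ws \<Longrightarrow> \<exists>!e. e \<in> P \<and> (l = fst e \<or> l = snd e)"
  unfolding complete_contraction_def by (elim conjE) (rule bspec)

lemma complete_contractionI:
  assumes "\<And>l k. (l, k) \<in> P \<Longrightarrow> l \<in> legs ws \<and> k \<in> legs ws \<and> leg_less l k \<and>
      contractible (fld (jet_at ws l)) (fld (jet_at ws k))"
    and "\<And>l. l \<in> legs ws \<Longrightarrow> \<exists>!e. e \<in> P \<and> (l = fst e \<or> l = snd e)"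
  shows "complete_contraction ws P"
  unfolding complete_contraction_def
proof (intro conjI ballI)
  show "P \<subseteq> legs ws \<times> legs ws"
    using assms(1) by auto
qed (use assms in auto)

lemma complete_contraction_finite:
  assumes "complete_contraction ws P"
  shows "finite P"
proof (rule finite_subset)
  show "P \<subseteq> legs ws \<times> legs ws"
    using assms by (simp add: complete_contraction_def)
qed simp

text \<open>Every leg is an end of exactly one line and the two ends of a line differ, so a sum over
  legs can be regrouped by lines. It is applied to the charge, to the constant 1 (which counts
  lines) and to the indicator of enclosed ghost legs.\<close>

lemma complete_contraction_sum:
  fixes f :: "leg \<Rightarrow> 'a::comm_monoid_add"
  assumes "complete_contraction ws P"
  shows "(\<Sum>l\<in>legs ws. f l) = (\<Sum>e\<in>P. f (fst e) + f (snd e))"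
proof -
  have P: "P \<subseteq> legs ws \<times> legs ws" and
    lines: "\<And>e. e \<in> P \<Longrightarrow> leg_less (fst e) (snd e)" and
    uniq: "\<And>l. l \<in> legs ws \<Longrightarrow> \<exists>!e. e \<in> P \<and> (l = fst e \<or> l = snd e)"
    using assms by (auto simp: complete_contraction_def)
  have legs: "legs ws = (\<Union>e\<in>P. {fst e, snd e})"
  proof
    show "legs ws \<subseteq> (\<Union>e\<in>P. {fst e, snd e})"
      using uniq by blast
    show "(\<Union>e\<in>P. {fst e, snd e}) \<subseteq> legs ws"
      using P by force
  qed
  have disj: "{fst e, snd e} \<inter> {fst e', snd e'} = {}" if "e \<in> P" "e' \<in> P" "e \<noteq> e'" for e e'
  proof -
    have False if "l \<in> {fst e, snd e}" "l \<in> {fst e', snd e'}" for l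
    proof -
      have "l \<in> legs ws"
        using that(1) P \<open>e \<in> P\<close> by auto
      from uniq[OF this] show False
        using that \<open>e \<in> P\<close> \<open>e' \<in> P\<close> \<open>e \<noteq> e'\<close> by blast
    qed
    then show ?thesis
      by blast
  qed
  have "(\<Sum>l\<in>legs ws. f l) = (\<Sum>e\<in>P. \<Sum>l\<in>{fst e, snd e}. f l)"
    unfolding legs using complete_contraction_finite[OF assms] disj
    by (intro sum.UNION_disjoint) auto
  also have "\<dots> = (\<Sum>e\<in>P. f (fst e) + f (snd e))"
  proof (rule sum.cong)
    fix e assume "e \<in> P"
    then have "fst e \<noteq> snd e"
      using lines[of e] by (metis leg_less_irrefl)
    then show "(\<Sum>l\<in>{fst e, snd e}. f l) = f (fst e) + f (snd e)"
      by simp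
  qed simp
  finally show ?thesis .
qed

lemma contractible_ghost: "contractible p q \<Longrightarrow> ghost p \<longleftrightarrow> ghost q"
  by (cases p; cases q; simp)

text \<open>The condition under which vertices of different components can be interleaved without a
  sign. The one-loop vertices satisfy it: each has no ghost leg or a ghost together with its
  antighost.\<close>

definition even_ghosts :: "jet list \<Rightarrow> bool" where
  "even_ghosts w \<longleftrightarrow> even (card {i. i < length w \<and> ghost (fld (w ! i))})"


text \<open>Carries the uniqueness of the line through a leg across a relabelling of the
  lines.\<close>

lemma ex1_image_iff:
  assumes "inj_on f A"
  shows "(\<exists>!y. \<exists>x\<in>A. y = f x \<and> Q x) \<longleftrightarrow> (\<exists>!x. x \<in> A \<and> Q x)"
proof
  assume "\<exists>!y. \<exists>x\<in>A. y = f x \<and> Q x"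
  then obtain x where x: "x \<in> A" "Q x" "\<And>x'. x' \<in> A \<Longrightarrow> Q x' \<Longrightarrow> f x' = f x"
    by blast
  then show "\<exists>!x. x \<in> A \<and> Q x"
    using inj_onD[OF assms] by (intro ex1I[of _ x]) blast+
next
  assume "\<exists>!x. x \<in> A \<and> Q x"
  then obtain x where "x \<in> A" "Q x" "\<And>x'. x' \<in> A \<Longrightarrow> Q x' \<Longrightarrow> x' = x"
    by blast
  then show "\<exists>!y. \<exists>x\<in>A. y = f x \<and> Q x"
    by (intro ex1I[of _ "f x"]) blast+
qed


section \<open>Merging two diagrams\<close>

definition relabel_leg :: "(nat \<Rightarrow> nat) \<Rightarrow> leg \<Rightarrow> leg" where
  "relabel_leg e l = (e (fst l), snd l)"

lemma fst_relabel_leg [simp]: "fst (relabel_leg e l) = e (fst l)"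
  by (simp add: relabel_leg_def)

definition relabel_line :: "(nat \<Rightarrow> nat) \<Rightarrow> leg \<times> leg \<Rightarrow> leg \<times> leg" where
  "relabel_line e p = (relabel_leg e (fst p), relabel_leg e (snd p))"

lemma relabel_line_simps [simp]:
  "fst (relabel_line e p) = relabel_leg e (fst p)"
  "snd (relabel_line e p) = relabel_leg e (snd p)"
  by (simp_all add: relabel_line_def)

text \<open>Lines are pulled back along \<open>e\<close>, so that those with an end outside the
  image of \<open>e\<close> disappear.\<close>

definition restrict_diagram :: "(nat \<Rightarrow> nat) \<Rightarrow> nat \<Rightarrow> diagram \<Rightarrow> diagram" where
  "restrict_diagram e m D = (map (\<lambda>v. fst D ! e v) [0..<m],
     {p. fst (fst p) < m \<and> fst (snd p) < m \<and> relabel_line e p \<in> snd D})"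

definition crossings :: "diagram \<Rightarrow> ((leg \<times> leg) \<times> (leg \<times> leg)) set" where
  "crossings D = {(e, f). e \<in> snd D \<and> f \<in> snd D \<and>
     ghost (fld (jet_at (fst D) (fst e))) \<and> ghost (fld (jet_at (fst D) (fst f))) \<and>
     leg_less (fst e) (fst f) \<and> leg_less (fst f) (snd e) \<and> leg_less (snd e) (snd f)}"

lemma fermi_sign_crossings: "fermi_sign D = (- 1) ^ card (crossings D)"
  by (simp add: fermi_sign_def crossings_def)

lemma adjacent_iff:
  "(v, w) \<in> adjacent D \<longleftrightarrow> (\<exists>e\<in>snd D. fst (fst e) = v \<and> fst (snd e) = w \<or> fst (fst e) = w \<and> fst (snd e) = v)"
  by (simp add: adjacent_def case_prod_unfold)

text \<open>The vertices of two diagrams are embedded monotonically into those of the merged diagram, so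
  that the orientation of the lines and the crossings within each part are preserved.\<close>

locale shuffle =
  fixes m n :: nat and e1 e2 :: "nat \<Rightarrow> nat"
  assumes mono1: "i < j \<Longrightarrow> j < m \<Longrightarrow> e1 i < e1 j"
    and mono2: "i < j \<Longrightarrow> j < n \<Longrightarrow> e2 i < e2 j"
    and disjoint: "i < m \<Longrightarrow> j < n \<Longrightarrow> e1 i \<noteq> e2 j"
    and cover: "e1 ` {..<m} \<union> e2 ` {..<n} = {..<m + n}"
begin

text \<open>The two parts play symmetric roles. Facts are proved for the first part only and
  obtained for the second by interpreting the locale with the parts exchanged.\<close>

lemma swap: "shuffle n m e2 e1"
  using mono1 mono2 disjoint cover by unfold_locales (auto simp: add.commute, metis)

lemma less_iff: "i < m \<Longrightarrow> j < m \<Longrightarrow> e1 i < e1 j \<longleftrightarrow> i < j"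
  by (metis mono1 less_asym linorder_neqE_nat)

lemma eq_iff: "i < m \<Longrightarrow> j < m \<Longrightarrow> e1 i = e1 j \<longleftrightarrow> i = j"
  by (metis mono1 less_irrefl linorder_neqE_nat)

lemma inj1: "inj_on e1 {..<m}"
  by (auto simp: inj_on_def eq_iff)

lemma bound: "i < m \<Longrightarrow> e1 i < m + n"
  using cover by auto

lemma relabel_leg_eq_iff:
  "fst l < m \<Longrightarrow> fst k < m \<Longrightarrow> relabel_leg e1 l = relabel_leg e1 k \<longleftrightarrow> l = k"
  by (auto simp: relabel_leg_def eq_iff prod_eq_iff)

lemma relabel_leg_neq: "fst l < m \<Longrightarrow> fst k < n \<Longrightarrow> relabel_leg e1 l \<noteq> relabel_leg e2 k"
  using disjoint by (auto simp: relabel_leg_def)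

lemma relabel_leg_less_iff:
  "fst l < m \<Longrightarrow> fst k < m \<Longrightarrow> leg_less (relabel_leg e1 l) (relabel_leg e1 k) \<longleftrightarrow> leg_less l k"
  by (auto simp: relabel_leg_def leg_less_def eq_iff less_iff)

text \<open>A relation rather than an operation, because it is reached from both sides: by joining
  two given diagrams, and by cutting a given one along a set of vertices closed under
  adjacency.\<close>

definition merges :: "diagram \<Rightarrow> diagram \<Rightarrow> diagram \<Rightarrow> bool" where
  "merges D1 D2 D \<longleftrightarrow>
     length (fst D1) = m \<and> length (fst D2) = n \<and> length (fst D) = m + n \<and>
     (\<forall>v<m. fst D ! e1 v = fst D1 ! v) \<and> (\<forall>v<n. fst D ! e2 v = fst D2 ! v) \<and>
     snd D1 \<subseteq> legs (fst D1) \<times> legs (fst D1) \<and> snd D2 \<subseteq> legs (fst D2) \<times> legs (fst D2) \<and>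
     snd D = relabel_line e1 ` snd D1 \<union> relabel_line e2 ` snd D2"

definition join :: "diagram \<Rightarrow> diagram \<Rightarrow> diagram" where
  "join D1 D2 = (map (\<lambda>v. if v \<in> e1 ` {..<m} then fst D1 ! inv_into {..<m} e1 v
                          else fst D2 ! inv_into {..<n} e2 v) [0..<m + n],
     relabel_line e1 ` snd D1 \<union> relabel_line e2 ` snd D2)"

lemma merges_swap: "merges D1 D2 D \<Longrightarrow> shuffle.merges n m e2 e1 D2 D1 D"
  by (simp add: merges_def shuffle.merges_def[OF swap] Un_commute add.commute)

lemma merges_join:
  assumes "length (fst D1) = m" "length (fst D2) = n"
    "snd D1 \<subseteq> legs (fst D1) \<times> legs (fst D1)" "snd D2 \<subseteq> legs (fst D2) \<times> legs (fst D2)"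
  shows "merges D1 D2 (join D1 D2)"
proof -
  interpret s: shuffle n m e2 e1 by (rule swap)
  have "e2 v \<notin> e1 ` {..<m}" if "v < n" for v
    using that disjoint by (metis imageE lessThan_iff)
  then show ?thesis
    using assms bound s.bound
    by (auto simp: merges_def join_def inv_into_f_f[OF inj1] inv_into_f_f[OF s.inj1] add.commute)
qed

context
  fixes D1 D2 D
  assumes merges: "merges D1 D2 D"
begin

lemma lengths: "length (fst D1) = m" "length (fst D2) = n" "length (fst D) = m + n"
  using merges by (auto simp: merges_def)

lemma lines_legs: "(l, k) \<in> snd D1 \<Longrightarrow> l \<in> legs (fst D1) \<and> k \<in> legs (fst D1)"
  using merges by (auto simp: merges_def)

lemma lines_bound: "e \<in> snd D1 \<Longrightarrow> fst (fst e) < m \<and> fst (snd e) < m"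
  using lines_legs[of "fst e" "snd e"] lengths by (auto simp: legs_def)

lemma lines: "snd D = relabel_line e1 ` snd D1 \<union> relabel_line e2 ` snd D2"
  using merges by (simp add: merges_def)

lemma words: "v < m \<Longrightarrow> fst D ! e1 v = fst D1 ! v"
  using merges by (simp add: merges_def)

lemma jet_at_relabel: "fst l < m \<Longrightarrow> jet_at (fst D) (relabel_leg e1 l) = jet_at (fst D1) l"
  by (simp add: jet_at_def relabel_leg_def words)

lemma legs_relabel: "fst l < m \<Longrightarrow> relabel_leg e1 l \<in> legs (fst D) \<longleftrightarrow> l \<in> legs (fst D1)"
  using lengths words bound by (auto simp: relabel_leg_def legs_def)

text \<open>Legs of different parts sit at different vertices, hence a line of \<open>D2\<close>
  never touches a leg that comes from \<open>D1\<close>.\<close>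

lemma line_relabel_mem:
  assumes "fst l < m"
  shows "e \<in> snd D \<and> (relabel_leg e1 l = fst e \<or> relabel_leg e1 l = snd e) \<longleftrightarrow>
    (\<exists>e'\<in>snd D1. e = relabel_line e1 e' \<and> (l = fst e' \<or> l = snd e'))"
proof -
  have right: "relabel_leg e1 l \<noteq> fst (relabel_line e2 e') \<and> relabel_leg e1 l \<noteq> snd (relabel_line e2 e')"
    if "e' \<in> snd D2" for e'
    using shuffle.lines_bound[OF swap merges_swap[OF merges] that] assms relabel_leg_neq by simp
  have left: "relabel_leg e1 l = fst (relabel_line e1 e') \<or> relabel_leg e1 l = snd (relabel_line e1 e')
      \<longleftrightarrow> l = fst e' \<or> l = snd e'"
    if "e' \<in> snd D1" for e'
    using lines_bound[OF that] assms relabel_leg_eq_iff by simp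
  show ?thesis (is "?L \<longleftrightarrow> ?R")
  proof
    assume ?L
    then consider e' where "e' \<in> snd D1" "e = relabel_line e1 e'"
      | e' where "e' \<in> snd D2" "e = relabel_line e2 e'"
      unfolding lines by blast
    then show ?R
      using \<open>?L\<close> by cases (use left right in blast)+
  next
    assume ?R
    then obtain e' where "e' \<in> snd D1" "e = relabel_line e1 e'" "l = fst e' \<or> l = snd e'"
      by blast
    then show ?L
      unfolding lines using left by blast
  qed
qed

lemma inj_on_relabel_line: "inj_on (relabel_line e1) (snd D1)"
proof (rule inj_onI)
  fix e f assume "e \<in> snd D1" "f \<in> snd D1" "relabel_line e1 e = relabel_line e1 f"
  then show "e = f"
    using lines_bound[of e] lines_bound[of f] relabel_leg_eq_iff
    by (metis relabel_line_simps prod_eq_iff)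
qed

lemma ex1_line_relabel:
  assumes "fst l < m"
  shows "(\<exists>!e. e \<in> snd D \<and> (relabel_leg e1 l = fst e \<or> relabel_leg e1 l = snd e)) \<longleftrightarrow>
    (\<exists>!e. e \<in> snd D1 \<and> (l = fst e \<or> l = snd e))"
  unfolding line_relabel_mem[OF assms] by (rule ex1_image_iff[OF inj_on_relabel_line])

lemma complete_restrict1:
  assumes "complete_contraction (fst D) (snd D)"
  shows "complete_contraction (fst D1) (snd D1)"
proof (rule complete_contractionI)
  fix l k assume lk: "(l, k) \<in> snd D1"
  then have "relabel_line e1 (l, k) \<in> snd D"
    unfolding lines by blast
  then have "(relabel_leg e1 l, relabel_leg e1 k) \<in> snd D"
    by (simp add: relabel_line_def)
  from complete_contraction_line[OF assms this]
  show "l \<in> legs (fst D1) \<and> k \<in> legs (fst D1) \<and> leg_less l k \<and>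
      contractible (fld (jet_at (fst D1) l)) (fld (jet_at (fst D1) k))"
    using lines_bound[OF lk] lines_legs[OF lk] by (simp add: jet_at_relabel relabel_leg_less_iff)
next
  fix l assume l: "l \<in> legs (fst D1)"
  then have bound: "fst l < m"
    using lengths by (auto simp: legs_def)
  show "\<exists>!e. e \<in> snd D1 \<and> (l = fst e \<or> l = snd e)"
    unfolding ex1_line_relabel[OF bound, symmetric]
    by (intro complete_contraction_ex1[OF assms]) (simp add: legs_relabel bound l)
qed

lemma leg_cases:
  assumes "l \<in> legs (fst D)"
  obtains (left) k where "k \<in> legs (fst D1)" "fst k < m" "l = relabel_leg e1 k"
  | (right) k where "k \<in> legs (fst D2)" "fst k < n" "l = relabel_leg e2 k"
proof -
  interpret s: shuffle n m e2 e1 by (rule swap)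
  have "fst l < m + n"
    using assms lengths by (auto simp: legs_def)
  then have "fst l \<in> e1 ` {..<m} \<union> e2 ` {..<n}"
    using cover by simp
  then consider v where "v < m" "l = relabel_leg e1 (v, snd l)"
    | v where "v < n" "l = relabel_leg e2 (v, snd l)"
    by (auto simp: relabel_leg_def prod_eq_iff)
  then show ?thesis
  proof cases
    case (1 v)
    then show ?thesis
      using assms legs_relabel left[of "(v, snd l)"] by (metis fst_conv)
  next
    case (2 v)
    then show ?thesis
      using assms s.legs_relabel[OF merges_swap[OF merges]] right[of "(v, snd l)"] by (metis fst_conv)
  qed
qed

lemma line_mem_relabel:
  assumes "complete_contraction (fst D1) (snd D1)" "(l, k) \<in> snd D1"
  shows "relabel_leg e1 l \<in> legs (fst D) \<and> relabel_leg e1 k \<in> legs (fst D) \<and>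
      leg_less (relabel_leg e1 l) (relabel_leg e1 k) \<and>
      contractible (fld (jet_at (fst D) (relabel_leg e1 l))) (fld (jet_at (fst D) (relabel_leg e1 k)))"
  using complete_contraction_line[OF assms] lines_bound[OF assms(2)]
  by (simp add: jet_at_relabel relabel_leg_less_iff legs_relabel)

end

lemma complete_merge:
  assumes "merges D1 D2 D"
    "complete_contraction (fst D1) (snd D1)" "complete_contraction (fst D2) (snd D2)"
  shows "complete_contraction (fst D) (snd D)"
proof -
  interpret s: shuffle n m e2 e1 by (rule swap)
  note merges = assms(1) merges_swap[OF assms(1)]
  have line: "l \<in> legs (fst D) \<and> k \<in> legs (fst D) \<and> leg_less l k \<and>
     contractible (fld (jet_at (fst D) l)) (fld (jet_at (fst D) k))" if "(l, k) \<in> snd D" for l k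
  proof -
    from that consider l' k' where "(l', k') \<in> snd D1" "(l, k) = relabel_line e1 (l', k')"
      | l' k' where "(l', k') \<in> snd D2" "(l, k) = relabel_line e2 (l', k')"
      unfolding lines[OF merges(1)] by auto
    then show ?thesis
    proof cases
      case 1
      then show ?thesis
        using line_mem_relabel[OF merges(1) assms(2)] by (simp add: relabel_line_def)
    next
      case 2
      then show ?thesis
        using s.line_mem_relabel[OF merges(2) assms(3)] by (simp add: relabel_line_def)
    qed
  qed
  have ex1: "\<exists>!e. e \<in> snd D \<and> (l = fst e \<or> l = snd e)" if "l \<in> legs (fst D)" for l
  proof (cases rule: leg_cases[OF merges(1) that, case_names left right])
    case (left k)
    then have "\<exists>!e. e \<in> snd D1 \<and> (k = fst e \<or> k = snd e)"
      by (intro complete_contraction_ex1[OF assms(2)])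
    then show ?thesis
      using ex1_line_relabel[OF merges(1) left(2)] left(3) by simp
  next
    case (right k)
    then have "\<exists>!e. e \<in> snd D2 \<and> (k = fst e \<or> k = snd e)"
      by (intro complete_contraction_ex1[OF assms(3)])
    then show ?thesis
      using s.ex1_line_relabel[OF merges(2) right(2)] right(3) by simp
  qed
  show ?thesis
    using line ex1 by (rule complete_contractionI)
qed


text \<open>The images of the two embeddings cover all vertices, so the parts determine the whole.
  Together with \<open>restrict_merge\<close> this makes cutting and joining inverse to each
  other.\<close>

lemma merges_unique:
  assumes "merges D1 D2 D" "merges D1 D2 D'"
  shows "D = D'"
proof (rule prod_eqI)
  show "fst D = fst D'"
  proof (rule nth_equalityI)
    fix v assume "v < length (fst D)"
    then have "v \<in> e1 ` {..<m} \<union> e2 ` {..<n}"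
      using cover assms(1) by (simp add: merges_def)
    then show "fst D ! v = fst D' ! v"
      using assms by (auto simp: merges_def)
  qed (use assms in \<open>simp add: merges_def\<close>)
  show "snd D = snd D'"
    using assms by (simp add: merges_def)
qed

lemma restrict_merge:
  assumes "merges D1 D2 D"
  shows "restrict_diagram e1 m D = D1"
proof (rule prod_eqI)
  show "fst (restrict_diagram e1 m D) = fst D1"
    using assms by (intro nth_equalityI) (auto simp: restrict_diagram_def merges_def)
  have "relabel_line e1 e \<in> snd D \<longleftrightarrow> e \<in> snd D1" if "fst (fst e) < m" "fst (snd e) < m" for e
  proof
    assume "relabel_line e1 e \<in> snd D"
    then obtain e' where "e' \<in> snd D" "relabel_line e1 e = e'"
      by simp
    then consider e' where "e' \<in> snd D1" "relabel_line e1 e = relabel_line e1 e'"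
      | e' where "e' \<in> snd D2" "relabel_line e1 e = relabel_line e2 e'"
      unfolding lines[OF assms] by auto
    then show "e \<in> snd D1"
    proof cases
      case 1
      then have "fst e = fst e'" "snd e = snd e'"
        using that lines_bound[OF assms 1(1)] relabel_leg_eq_iff by (metis relabel_line_simps)+
      then show ?thesis
        using 1(1) by (metis prod_eqI)
    next
      case 2
      then show ?thesis
        using that shuffle.lines_bound[OF swap merges_swap[OF assms] 2(1)] relabel_leg_neq
        by (metis relabel_line_simps)
    qed
  next
    assume "e \<in> snd D1"
    then show "relabel_line e1 e \<in> snd D"
      unfolding lines[OF assms] by blast
  qed
  then show "snd (restrict_diagram e1 m D) = snd D1"
    using lines_bound[OF assms] unfolding restrict_diagram_def snd_conv by blast
qed

lemma merges_restrict:
  assumes D: "length (fst D) = m + n" "snd D \<subseteq> legs (fst D) \<times> legs (fst D)"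
    and closed: "\<And>v w. (v, w) \<in> adjacent D \<Longrightarrow> v \<in> e1 ` {..<m} \<Longrightarrow> w \<in> e1 ` {..<m}"
  shows "merges (restrict_diagram e1 m D) (restrict_diagram e2 n D) D"
proof -
  interpret s: shuffle n m e2 e1 by (rule swap)
  have sub: "snd (restrict_diagram e1 m D) \<subseteq> legs (fst (restrict_diagram e1 m D)) \<times> legs (fst (restrict_diagram e1 m D))"
    "snd (restrict_diagram e2 n D) \<subseteq> legs (fst (restrict_diagram e2 n D)) \<times> legs (fst (restrict_diagram e2 n D))"
    using D(2) by (auto simp: restrict_diagram_def legs_def relabel_line_def relabel_leg_def)
  have "snd D = relabel_line e1 ` snd (restrict_diagram e1 m D) \<union> relabel_line e2 ` snd (restrict_diagram e2 n D)"
  proof (intro equalityI subsetI)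
    fix e assume e: "e \<in> snd D"
    obtain v i w j where vw: "e = ((v, i), (w, j))"
      by (metis prod.exhaust)
    have "v \<in> {..<m + n}" "w \<in> {..<m + n}"
      using e vw D by (auto simp: legs_def)
    \<comment> \<open>Adjacency is symmetric, so closedness of the first part excludes lines between
      the parts in either direction.\<close>
    moreover have "(v, w) \<in> adjacent D" "(w, v) \<in> adjacent D"
      using e vw unfolding adjacent_def by force+
    ultimately consider "v \<in> e1 ` {..<m}" "w \<in> e1 ` {..<m}" | "v \<in> e2 ` {..<n}" "w \<in> e2 ` {..<n}"
      unfolding cover[symmetric] using closed[of v w] closed[of w v] by blast
    then show "e \<in> relabel_line e1 ` snd (restrict_diagram e1 m D) \<union> relabel_line e2 ` snd (restrict_diagram e2 n D)"
    proof cases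
      case 1
      then obtain v' w' where "v' < m" "w' < m" "v = e1 v'" "w = e1 w'"
        by auto
      then have "e = relabel_line e1 ((v', i), (w', j))" "((v', i), (w', j)) \<in> snd (restrict_diagram e1 m D)"
        using e vw by (auto simp: relabel_line_def relabel_leg_def restrict_diagram_def)
      then show ?thesis
        by blast
    next
      case 2
      then obtain v' w' where "v' < n" "w' < n" "v = e2 v'" "w = e2 w'"
        by auto
      then have "e = relabel_line e2 ((v', i), (w', j))" "((v', i), (w', j)) \<in> snd (restrict_diagram e2 n D)"
        using e vw by (auto simp: relabel_line_def relabel_leg_def restrict_diagram_def)
      then show ?thesis
        by blast
    qed
  qed (auto simp: restrict_diagram_def)
  then show ?thesis
    using D sub by (auto simp: merges_def restrict_diagram_def)
qed

section \<open>Connected components of a merged diagram\<close>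

lemma adjacent_merge:
  assumes "merges D1 D2 D" "v < m"
  shows "(e1 v, w) \<in> adjacent D \<longleftrightarrow> (\<exists>w'<m. w = e1 w' \<and> (v, w') \<in> adjacent D1)"
proof
  assume "(e1 v, w) \<in> adjacent D"
  then obtain e where e: "e \<in> snd D"
    "fst (fst e) = e1 v \<and> fst (snd e) = w \<or> fst (fst e) = w \<and> fst (snd e) = e1 v"
    unfolding adjacent_iff by blast
  then consider e' where "e' \<in> snd D1" "e = relabel_line e1 e'"
    | e' where "e' \<in> snd D2" "e = relabel_line e2 e'"
    unfolding lines[OF assms(1)] by auto
  then show "\<exists>w'<m. w = e1 w' \<and> (v, w') \<in> adjacent D1"
  proof cases
    case 1
    have "fst (fst e') < m" "fst (snd e') < m"
      using lines_bound[OF assms(1) 1(1)] by auto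
    moreover from this have "fst (fst e') = v \<and> e1 (fst (snd e')) = w \<or> e1 (fst (fst e')) = w \<and> fst (snd e') = v"
      using e(2) 1(2) assms(2) by (auto simp: relabel_leg_def eq_iff)
    ultimately show ?thesis
      using 1(1) unfolding adjacent_iff by metis
  next
    case 2
    then show ?thesis
      using e(2) assms(2) disjoint shuffle.lines_bound[OF swap merges_swap[OF assms(1)] 2(1)]
      by (auto simp: relabel_leg_def) metis+
  qed
next
  assume "\<exists>w'<m. w = e1 w' \<and> (v, w') \<in> adjacent D1"
  then obtain w' e' where e': "w = e1 w'" "e' \<in> snd D1"
    "fst (fst e') = v \<and> fst (snd e') = w' \<or> fst (fst e') = w' \<and> fst (snd e') = v"
    unfolding adjacent_iff by blast
  then have "relabel_line e1 e' \<in> snd D"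
    unfolding lines[OF assms(1)] by blast
  then show "(e1 v, w) \<in> adjacent D"
    using e' unfolding adjacent_iff by (metis fst_conv relabel_leg_def relabel_line_simps)
qed

lemma reachable_merge:
  assumes "merges D1 D2 D" "v < m"
  shows "(e1 v, w) \<in> (adjacent D)\<^sup>* \<longleftrightarrow> (\<exists>w'<m. w = e1 w' \<and> (v, w') \<in> (adjacent D1)\<^sup>*)"
proof
  assume "(e1 v, w) \<in> (adjacent D)\<^sup>*"
  then show "\<exists>w'<m. w = e1 w' \<and> (v, w') \<in> (adjacent D1)\<^sup>*"
  proof (induction rule: rtrancl_induct)
    case base
    then show ?case
      using assms(2) by blast
  next
    case (step x y)
    then obtain x' where "x' < m" "x = e1 x'" "(v, x') \<in> (adjacent D1)\<^sup>*"
      by blast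
    then show ?case
      using step(2) adjacent_merge[OF assms(1), of x' y] by (meson rtrancl.rtrancl_into_rtrancl)
  qed
next
  have "(v, w') \<in> (adjacent D1)\<^sup>* \<Longrightarrow> w' < m \<Longrightarrow> (e1 v, e1 w') \<in> (adjacent D)\<^sup>*" for w'
  proof (induction rule: rtrancl_induct)
    case (step x y)
    \<comment> \<open>The bound on the last vertex of a path says nothing about the vertices before
      it; these are bounded because they are ends of lines of \<open>D1\<close>.\<close>
    then obtain e where "e \<in> snd D1" "fst (fst e) = x \<or> fst (snd e) = x"
      unfolding adjacent_iff by blast
    then have "x < m"
      using lines_bound[OF assms(1)] by blast
    moreover from this have "(e1 x, e1 y) \<in> adjacent D"
      using adjacent_merge[OF assms(1)] step by blast
    ultimately show ?case
      using step by (meson rtrancl.rtrancl_into_rtrancl)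
  qed simp
  then show "\<exists>w'<m. w = e1 w' \<and> (v, w') \<in> (adjacent D1)\<^sup>* \<Longrightarrow> (e1 v, w) \<in> (adjacent D)\<^sup>*"
    by blast
qed

text \<open>Paths that start in the first part stay in it, so the component of 0 is the image of the
  component of its preimage. Reachability is symmetric and transitive, and so it is enough to look
  at the paths from that single vertex.\<close>

lemma connected_merge:
  assumes "merges D1 D2 D" "0 \<in> e1 ` {..<m}"
  shows "{v. (0, v) \<in> (adjacent D)\<^sup>*} = e1 ` {..<m} \<longleftrightarrow> connected_diagram D1"
proof -
  obtain z where z: "z < m" "e1 z = 0"
    using assms(2) by auto
  have len: "length (fst D1) = m"
    using lengths[OF assms(1)] by simp
  have "{v. (0, v) \<in> (adjacent D)\<^sup>*} = e1 ` {w. w < m \<and> (z, w) \<in> (adjacent D1)\<^sup>*}"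
    using reachable_merge[OF assms(1) z(1)] z(2) by auto
  also have "\<dots> = e1 ` {..<m} \<longleftrightarrow> {w. w < m \<and> (z, w) \<in> (adjacent D1)\<^sup>*} = {..<m}"
    by (intro inj_on_image_eq_iff[OF inj1]) auto
  also have "\<dots> \<longleftrightarrow> (\<forall>w<m. (z, w) \<in> (adjacent D1)\<^sup>*)"
    by auto
  also have "\<dots> \<longleftrightarrow> (\<forall>v<m. \<forall>w<m. (v, w) \<in> (adjacent D1)\<^sup>*)"
  proof -
    have "sym ((adjacent D1)\<^sup>*)"
      by (intro sym_rtrancl) (auto simp: sym_def adjacent_def)
    then show ?thesis
      using z(1) by (meson rtrancl_trans symD)
  qed
  also have "\<dots> \<longleftrightarrow> connected_diagram D1"
    using len z(1) by (auto simp: connected_diagram_def)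
  finally show ?thesis .
qed


section \<open>Factorization of the Fermi sign and of the integrand\<close>

lemma prod_split:
  fixes h :: "nat \<Rightarrow> 'a::comm_monoid_mult"
  shows "(\<Prod>v<m + n. h v) = (\<Prod>v<m. h (e1 v)) * (\<Prod>v<n. h (e2 v))"
proof -
  interpret s: shuffle n m e2 e1 by (rule swap)
  have "(\<Prod>v<m + n. h v) = (\<Prod>v\<in>e1 ` {..<m}. h v) * (\<Prod>v\<in>e2 ` {..<n}. h v)"
    unfolding cover[symmetric] using disjoint by (intro prod.union_disjoint) auto
  then show ?thesis
    by (simp add: prod.reindex[OF inj1] prod.reindex[OF s.inj1])
qed

lemma lines_disjoint:
  assumes "merges D1 D2 D"
  shows "relabel_line e1 ` snd D1 \<inter> relabel_line e2 ` snd D2 = {}"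
proof -
  have "relabel_line e1 e \<noteq> relabel_line e2 f" if "e \<in> snd D1" "f \<in> snd D2" for e f
    using lines_bound[OF assms that(1)] shuffle.lines_bound[OF swap merges_swap[OF assms] that(2)]
      relabel_leg_neq by (metis relabel_line_simps)
  then show ?thesis
    by blast
qed

lemma lines_finite: "merges D1 D2 D \<Longrightarrow> finite (snd D1)"
  unfolding merges_def by (meson finite_SigmaI finite_legs finite_subset)

lemma prod_lines:
  fixes h :: "leg \<times> leg \<Rightarrow> 'a::comm_monoid_mult"
  assumes "merges D1 D2 D"
  shows "(\<Prod>e\<in>snd D. h e) = (\<Prod>e\<in>snd D1. h (relabel_line e1 e)) * (\<Prod>e\<in>snd D2. h (relabel_line e2 e))"
proof -
  interpret s: shuffle n m e2 e1 by (rule swap)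
  note swapped = merges_swap[OF assms]
  show ?thesis
    unfolding lines[OF assms]
    using lines_disjoint[OF assms] lines_finite[OF assms] s.lines_finite[OF swapped]
    by (subst prod.union_disjoint)
      (auto simp: prod.reindex[OF inj_on_relabel_line[OF assms]] prod.reindex[OF s.inj_on_relabel_line[OF swapped]])
qed

abbreviation ghost_line :: "diagram \<Rightarrow> leg \<times> leg \<Rightarrow> bool" where
  "ghost_line D e \<equiv> ghost (fld (jet_at (fst D) (fst e)))"

abbreviation crosses :: "leg \<times> leg \<Rightarrow> leg \<times> leg \<Rightarrow> bool" where
  "crosses e f \<equiv> leg_less (fst e) (fst f) \<and> leg_less (fst f) (snd e) \<and> leg_less (snd e) (snd f)"

text \<open>A line of \<open>D2\<close> encloses complete vertices of \<open>D1\<close>, hence an even number of ghost legs of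
  \<open>D1\<close>; a ghost line of \<open>D1\<close> crosses it if and only if exactly one end is enclosed.\<close>

lemma even_crossings_line:
  assumes merges: "merges D1 D2 D"
    and complete: "complete_contraction (fst D1) (snd D1)" "complete_contraction (fst D2) (snd D2)"
    and even: "\<And>w. w \<in> set (fst D1) \<Longrightarrow> even_ghosts w"
    and f: "f \<in> snd D2"
  shows "even (\<Sum>e | e \<in> snd D1 \<and> ghost_line D1 e.
      of_bool (crosses (relabel_line e1 e) (relabel_line e2 f)) +
      (of_bool (crosses (relabel_line e2 f) (relabel_line e1 e)) :: nat))"
proof -
  let ?f = "relabel_line e2 f"
  \<comment> \<open>Comparing vertices instead of legs loses nothing, since a line of
    \<open>D2\<close> has no end at a vertex of \<open>D1\<close>.\<close>
  define enclosed where "enclosed v \<longleftrightarrow> fst (fst ?f) < v \<and> v < fst (snd ?f)" for v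
  let ?c = "\<lambda>e. of_bool (crosses (relabel_line e1 e) ?f) + (of_bool (crosses ?f (relabel_line e1 e)) :: nat)"
  let ?g = "\<lambda>l. (of_bool (ghost (fld (jet_at (fst D1) l)) \<and> enclosed (e1 (fst l))) :: nat)"
  have fless: "leg_less (fst ?f) (snd ?f)"
  proof -
    interpret s: shuffle n m e2 e1 by (rule swap)
    have "leg_less (fst f) (snd f)"
      using complete_contraction_line(3)[OF complete(2)] f by (metis prod.collapse)
    then show ?thesis
      using s.relabel_leg_less_iff s.lines_bound[OF merges_swap[OF merges] f] by simp
  qed
  \<comment> \<open>For a ghost line this sum is 0 or 2: if exactly one end is enclosed there is one
    crossing; if both or none are, the lines are nested or apart and there is no crossing. For other
    lines all terms vanish.\<close>
  have parity: "even (?g (fst e) + ?g (snd e) + (if ghost_line D1 e then ?c e else 0))" if e: "e \<in> snd D1" for e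
  proof -
    have "(fst e, snd e) \<in> snd D1"
      using e by simp
    note line = complete_contraction_line[OF complete(1) this]
    have bound: "fst (fst e) < m" "fst (snd e) < m"
      using lines_bound[OF merges e] by auto
    have less: "leg_less (fst (relabel_line e1 e)) (snd (relabel_line e1 e))"
      using line(3) bound by (simp add: relabel_leg_less_iff)
    have ghost: "ghost (fld (jet_at (fst D1) (snd e))) \<longleftrightarrow> ghost_line D1 e"
      using contractible_ghost[OF line(4)] by simp
    have neq: "e1 (fst (fst e)) \<noteq> fst (fst ?f)" "e1 (fst (fst e)) \<noteq> fst (snd ?f)"
      "e1 (fst (snd e)) \<noteq> fst (fst ?f)" "e1 (fst (snd e)) \<noteq> fst (snd ?f)"
      using bound disjoint shuffle.lines_bound[OF swap merges_swap[OF merges] f]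
      by (auto simp: relabel_leg_def)
    have le: "e1 (fst (fst e)) \<le> e1 (fst (snd e))" "fst (fst ?f) \<le> fst (snd ?f)"
      using less fless by (auto simp: leg_less_def relabel_leg_def)
    show ?thesis
      unfolding ghost enclosed_def using neq le
      by (auto simp: leg_less_def relabel_leg_def)
  qed
  have "even (\<Sum>l\<in>legs (fst D1). ?g l)"
  proof -
    have vertex: "even (\<Sum>i<length (fst D1 ! v). ?g (v, i))" if "v < length (fst D1)" for v
    proof (cases "enclosed (e1 v)")
      case True
      then have "(\<Sum>i<length (fst D1 ! v). ?g (v, i)) =
          card {i. i < length (fst D1 ! v) \<and> ghost (fld (fst D1 ! v ! i))}"
        by (simp add: jet_at_def sum.If_cases of_bool_def Int_def)
      then show ?thesis
        using even[of "fst D1 ! v"] that by (simp add: even_ghosts_def)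
    qed simp
    show ?thesis
      unfolding sum_legs by (rule dvd_sum, rule vertex) simp
  qed
  then have "even (\<Sum>e\<in>snd D1. ?g (fst e) + ?g (snd e))"
    using complete_contraction_sum[OF complete(1), of ?g] by simp
  moreover have "even ((\<Sum>e\<in>snd D1. ?g (fst e) + ?g (snd e)) + (\<Sum>e\<in>snd D1. if ghost_line D1 e then ?c e else 0))"
    unfolding sum.distrib[symmetric] by (intro dvd_sum parity)
  ultimately have "even (\<Sum>e\<in>snd D1. if ghost_line D1 e then ?c e else 0)"
    by simp
  then show ?thesis
    by (subst sum.inter_filter[OF lines_finite[OF merges]])
qed

text \<open>Increasing embeddings keep the crossings within each part; only pairs with one line from
  each part are new, and their number is even for every fixed line of \<open>D2\<close>.\<close>

lemma fermi_sign_merge: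
  assumes merges: "merges D1 D2 D"
    and complete: "complete_contraction (fst D1) (snd D1)" "complete_contraction (fst D2) (snd D2)"
    and even: "\<And>w. w \<in> set (fst D1) \<Longrightarrow> even_ghosts w"
  shows "fermi_sign D = fermi_sign D1 * fermi_sign D2"
proof -
  interpret s: shuffle n m e2 e1 by (rule swap)
  note swapped = merges_swap[OF merges]
  note fin = lines_finite[OF merges] s.lines_finite[OF swapped]
  let ?G = "\<lambda>E. {e \<in> snd E. ghost_line E e}"
  let ?R1 = "relabel_line e1" and ?R2 = "relabel_line e2"
  let ?c = "\<lambda>e f. (of_bool (crosses e f) :: nat)"
  have card: "card (crossings E) = (\<Sum>e\<in>?G E. \<Sum>f\<in>?G E. ?c e f)" if "finite (snd E)" for E
  proof -
    have "crossings E = (SIGMA e:?G E. {f \<in> ?G E. crosses e f})"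
      by (auto simp: crossings_def)
    then show ?thesis
      using that by (simp add: card_SigmaI Int_def)
  qed
  have ghost1: "ghost_line D (?R1 e) \<longleftrightarrow> ghost_line D1 e" if "e \<in> snd D1" for e
    using lines_bound[OF merges that] jet_at_relabel[OF merges] by simp
  have ghost2: "ghost_line D (?R2 e) \<longleftrightarrow> ghost_line D2 e" if "e \<in> snd D2" for e
    using s.lines_bound[OF swapped that] s.jet_at_relabel[OF swapped] by simp
  have G: "?G D = ?R1 ` ?G D1 \<union> ?R2 ` ?G D2"
    unfolding lines[OF merges] using ghost1 ghost2 by blast
  have sum_G: "(\<Sum>e\<in>?G D. h e) = (\<Sum>e\<in>?G D1. h (?R1 e)) + (\<Sum>e\<in>?G D2. h (?R2 e))" for h :: "_ \<Rightarrow> nat"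
  proof -
    have "inj_on ?R1 (?G D1)" "inj_on ?R2 (?G D2)"
      using inj_on_relabel_line[OF merges] s.inj_on_relabel_line[OF swapped]
      by (auto elim!: inj_on_subset)
    moreover have "?R1 ` ?G D1 \<inter> ?R2 ` ?G D2 = {}"
      using lines_disjoint[OF merges] by blast
    ultimately show ?thesis
      unfolding G using fin by (subst sum.union_disjoint) (simp_all add: sum.reindex)
  qed
  have inner1: "?c (?R1 e) (?R1 f) = ?c e f" if "e \<in> ?G D1" "f \<in> ?G D1" for e f
    using that lines_bound[OF merges] by (simp add: relabel_leg_less_iff)
  have inner2: "?c (?R2 e) (?R2 f) = ?c e f" if "e \<in> ?G D2" "f \<in> ?G D2" for e f
    using that s.lines_bound[OF swapped] by (simp add: s.relabel_leg_less_iff)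
  \<comment> \<open>The mixed pairs in both orders, with the line of \<open>D2\<close> outermost so
    that the parity can be settled line by line.\<close>
  let ?X = "\<Sum>f\<in>?G D2. \<Sum>e\<in>?G D1. ?c (?R1 e) (?R2 f) + ?c (?R2 f) (?R1 e)"
  have "finite (snd D)"
    using fin by (simp add: lines[OF merges])
  then have "card (crossings D) = (\<Sum>e\<in>?G D. \<Sum>f\<in>?G D. ?c e f)"
    by (rule card)
  also have "\<dots> = (\<Sum>e\<in>?G D1. \<Sum>f\<in>?G D1. ?c (?R1 e) (?R1 f)) + (\<Sum>e\<in>?G D1. \<Sum>f\<in>?G D2. ?c (?R1 e) (?R2 f)) +
      ((\<Sum>e\<in>?G D2. \<Sum>f\<in>?G D1. ?c (?R2 e) (?R1 f)) + (\<Sum>e\<in>?G D2. \<Sum>f\<in>?G D2. ?c (?R2 e) (?R2 f)))"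
    by (simp only: sum_G sum.distrib add_ac)
  also have "\<dots> = card (crossings D1) + card (crossings D2) + ?X"
  proof -
    have "(\<Sum>e\<in>?G D1. \<Sum>f\<in>?G D1. ?c (?R1 e) (?R1 f)) = card (crossings D1)"
      "(\<Sum>e\<in>?G D2. \<Sum>f\<in>?G D2. ?c (?R2 e) (?R2 f)) = card (crossings D2)"
      unfolding card[OF fin(1)] card[OF fin(2)] using inner1 inner2 by (intro sum.cong refl; blast)+
    moreover have "?X = (\<Sum>e\<in>?G D1. \<Sum>f\<in>?G D2. ?c (?R1 e) (?R2 f)) + (\<Sum>e\<in>?G D2. \<Sum>f\<in>?G D1. ?c (?R2 e) (?R1 f))"
      unfolding sum.distrib by (subst sum.swap) (rule refl)
    ultimately show ?thesis
      by presburger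
  qed
  finally have "card (crossings D) = card (crossings D1) + card (crossings D2) + ?X" .
  moreover have "even ?X"
    by (intro dvd_sum even_crossings_line[OF merges complete even]) auto
  ultimately show ?thesis
    by (simp only: fermi_sign_crossings power_add) (simp add: uminus_power_if)
qed

lemma integrand_merge:
  assumes merges: "merges D1 D2 D"
    and complete: "complete_contraction (fst D1) (snd D1)" "complete_contraction (fst D2) (snd D2)"
    and even: "\<And>w. w \<in> set (fst D1) \<Longrightarrow> even_ghosts w"
  shows "diagram_integrand g L D x = diagram_integrand g L D1 (x \<circ> e1) * diagram_integrand g L D2 (x \<circ> e2)"
proof -
  interpret s: shuffle n m e2 e1 by (rule swap)
  note swapped = merges_swap[OF merges]
  let ?c = "\<lambda>D x e. contraction g (jet_at (fst D) (fst e)) (jet_at (fst D) (snd e)) (x (fst (fst e))) (x (fst (snd e)))"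
  have "(\<Prod>v<m + n. cplx_fps (L (fst D ! v) (x v))) =
      (\<Prod>v<m. cplx_fps (L (fst D1 ! v) ((x \<circ> e1) v))) * (\<Prod>v<n. cplx_fps (L (fst D2 ! v) ((x \<circ> e2) v)))"
    unfolding prod_split by (simp add: words[OF merges] s.words[OF swapped])
  moreover have "(\<Prod>e\<in>snd D. ?c D x e) = (\<Prod>e\<in>snd D1. ?c D1 (x \<circ> e1) e) * (\<Prod>e\<in>snd D2. ?c D2 (x \<circ> e2) e)"
  proof -
    have "?c D x (relabel_line e1 e) = ?c D1 (x \<circ> e1) e" if "e \<in> snd D1" for e
      using lines_bound[OF merges that] by (simp add: jet_at_relabel[OF merges])
    moreover have "?c D x (relabel_line e2 e) = ?c D2 (x \<circ> e2) e" if "e \<in> snd D2" for e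
      using s.lines_bound[OF swapped that] by (simp add: s.jet_at_relabel[OF swapped])
    ultimately show ?thesis
      unfolding prod_lines[OF merges] by simp
  qed
  moreover have "fermi_sign D = fermi_sign D1 * fermi_sign D2"
    using assms by (rule fermi_sign_merge)
  ultimately show ?thesis
    unfolding diagram_integrand_def case_prod_unfold lengths[OF merges]
    by (simp add: mult_ac flip: fps_const_mult)
qed

end

section \<open>Formal integration\<close>

definition integrand_fps :: "nat \<Rightarrow> ((nat \<Rightarrow> pt) \<Rightarrow> complex fps) \<Rightarrow> bool" where
  "integrand_fps n F \<longleftrightarrow> (\<forall>x y. (\<forall>v<n. x v = y v) \<longrightarrow> F x = F y)"

lemma integrand_ofD: "integrand_of n f \<Longrightarrow> (\<And>v. v < n \<Longrightarrow> x v = y v) \<Longrightarrow> f x = f y"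
  by (simp add: integrand_of_def)

lemma integrand_of_nth: "integrand_fps n F \<Longrightarrow> integrand_of n (\<lambda>x. fps_nth (F x) k)"
  unfolding integrand_fps_def integrand_of_def by metis

locale formal_integration =
  fixes I :: "nat \<Rightarrow> ((nat \<Rightarrow> pt) \<Rightarrow> complex) \<Rightarrow> complex"
  assumes formal_integral: "formal_integral I"
begin

lemma linear:
  "integrand_of n f \<Longrightarrow> integrand_of n h \<Longrightarrow> I n (\<lambda>x. a * f x + b * h x) = a * I n f + b * I n h"
  using formal_integral by (simp add: formal_integral_def)

lemma permute: "integrand_of n f \<Longrightarrow> \<pi> permutes {..<n} \<Longrightarrow> I n (\<lambda>x. f (x \<circ> \<pi>)) = I n f"
  using formal_integral by (simp add: formal_integral_def)

lemma factorize:
  "integrand_of m f \<Longrightarrow> integrand_of n h \<Longrightarrow> I (m + n) (\<lambda>x. f x * h (\<lambda>v. x (m + v))) = I m f * I n h"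
  using formal_integral by (simp add: formal_integral_def)

lemma one: "I 0 (\<lambda>x. 1) = 1"
  using formal_integral by (simp add: formal_integral_def)

lemma zero: "I n (\<lambda>x. 0) = 0"
  using linear[of n "\<lambda>x. 0" "\<lambda>x. 0" 0 0] by (simp add: integrand_of_def)

lemma sum:
  assumes "finite A" "\<And>i. i \<in> A \<Longrightarrow> integrand_of n (f i)"
  shows "I n (\<lambda>x. \<Sum>i\<in>A. f i x) = (\<Sum>i\<in>A. I n (f i))"
  using assms
proof (induction A rule: finite_induct)
  case (insert j A)
  have "integrand_of n (\<lambda>x. \<Sum>i\<in>A. f i x)"
    using insert(4) unfolding integrand_of_def by (intro allI impI sum.cong) auto
  then show ?case
    using insert linear[of n "f j" "\<lambda>x. \<Sum>i\<in>A. f i x" 1 1] by simp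
qed (simp add: zero)

text \<open>The postulates factorize only over two consecutive blocks of variables. A permutation
  carries these blocks onto the interleaved images of \<open>e1\<close> and \<open>e2\<close>, and
  the integral is invariant under it.\<close>

lemma factorize_shuffle:
  assumes "shuffle m n e1 e2" "integrand_of m f" "integrand_of n h"
  shows "I (m + n) (\<lambda>x. f (x \<circ> e1) * h (x \<circ> e2)) = I m f * I n h"
proof -
  interpret shuffle m n e1 e2 by fact
  interpret s: shuffle n m e2 e1 by (rule swap)
  \<comment> \<open>The block below \<open>m\<close> goes to the image of \<open>e1\<close>, the
    block from \<open>m\<close> on to that of \<open>e2\<close>; a permutation of
    \<open>{..<m + n}\<close> has to fix everything else.\<close>
  define \<pi> where "\<pi> v = (if v < m then e1 v else if v < m + n then e2 (v - m) else v)" for v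
  let ?F = "\<lambda>x. f x * h (\<lambda>v. x (m + v))"
  have "\<pi> ` {..<m + n} = {..<m + n}"
  proof -
    have "x \<in> (+) m ` {..<n}" if "\<not> x < m" "x < m + n" for x
      using that by (intro image_eqI[of _ _ "x - m"]) auto
    then have "{..<m + n} = {..<m} \<union> (+) m ` {..<n}"
      by auto
    then have "\<pi> ` {..<m + n} = \<pi> ` {..<m} \<union> \<pi> ` ((+) m ` {..<n})"
      by (simp add: image_Un)
    also have "\<dots> = e1 ` {..<m} \<union> e2 ` {..<n}"
      unfolding image_image by (intro arg_cong2[of _ _ _ _ "(\<union>)"] image_cong) (simp_all add: \<pi>_def)
    finally show ?thesis
      by (simp add: cover)
  qed
  then have "bij_betw \<pi> {..<m + n} {..<m + n}"
    by (simp add: bij_betw_def eq_card_imp_inj_on)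
  then have \<pi>: "\<pi> permutes {..<m + n}"
    by (rule bij_imp_permutes) (simp add: \<pi>_def)
  have "integrand_of (m + n) ?F"
    unfolding integrand_of_def
    by (intro allI impI arg_cong2[of _ _ _ _ "(*)"] integrand_ofD[OF assms(2)] integrand_ofD[OF assms(3)]) auto
  then have "I (m + n) (\<lambda>x. ?F (x \<circ> \<pi>)) = I m f * I n h"
    using permute[of "m + n" ?F, OF _ \<pi>] factorize[OF assms(2,3)] by simp
  moreover have "?F (x \<circ> \<pi>) = f (x \<circ> e1) * h (x \<circ> e2)" for x
  proof -
    have "f (x \<circ> \<pi>) = f (x \<circ> e1)"
      using assms(2) unfolding integrand_of_def by (auto simp: \<pi>_def)
    moreover have "h (\<lambda>v. (x \<circ> \<pi>) (m + v)) = h (x \<circ> e2)"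
      using assms(3) unfolding integrand_of_def by (auto simp: \<pi>_def)
    ultimately show ?thesis
      by simp
  qed
  ultimately show ?thesis
    by simp
qed

lemma integrate_sum:
  assumes "finite A" "\<And>i. i \<in> A \<Longrightarrow> integrand_fps n (F i)"
  shows "integrate I n (\<lambda>x. \<Sum>i\<in>A. F i x) = (\<Sum>i\<in>A. integrate I n (F i))"
  using assms by (intro fps_ext) (simp add: integrate_def fps_sum_nth sum integrand_of_nth)

lemma integrate_shuffle:
  assumes "shuffle m n e1 e2" "integrand_fps m F" "integrand_fps n H"
  shows "integrate I (m + n) (\<lambda>x. F (x \<circ> e1) * H (x \<circ> e2)) = integrate I m F * integrate I n H"
proof (rule fps_ext)
  fix k
  interpret shuffle m n e1 e2 by fact
  interpret s: shuffle n m e2 e1 by (rule swap)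
  have "integrand_of (m + n) (\<lambda>x. fps_nth (F (x \<circ> e1)) i * fps_nth (H (x \<circ> e2)) j)" for i j
  proof -
    have eq: "F (x \<circ> e1) = F (y \<circ> e1) \<and> H (x \<circ> e2) = H (y \<circ> e2)" if "\<forall>v<m + n. x v = y v" for x y
      using assms(2,3) that bound s.bound unfolding integrand_fps_def by (auto simp: add.commute)
    show ?thesis
      unfolding integrand_of_def
    proof (intro allI impI)
      fix x y :: "nat \<Rightarrow> pt" assume "\<forall>v<m + n. x v = y v"
      from eq[OF this] show "fps_nth (F (x \<circ> e1)) i * fps_nth (H (x \<circ> e2)) j =
          fps_nth (F (y \<circ> e1)) i * fps_nth (H (y \<circ> e2)) j"
        by simp
    qed
  qed
  moreover have "I (m + n) (\<lambda>x. fps_nth (F (x \<circ> e1)) i * fps_nth (H (x \<circ> e2)) j) =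
      I m (\<lambda>x. fps_nth (F x) i) * I n (\<lambda>x. fps_nth (H x) j)" for i j
    using factorize_shuffle[OF assms(1) integrand_of_nth[OF assms(2)] integrand_of_nth[OF assms(3)]] .
  ultimately show "fps_nth (integrate I (m + n) (\<lambda>x. F (x \<circ> e1) * H (x \<circ> e2))) k =
      fps_nth (integrate I m F * integrate I n H) k"
    by (simp add: integrate_def fps_mult_nth sum)
qed

end

section \<open>The linked cluster theorem\<close>

text \<open>The increasing enumerations of \<open>S\<close> and of its complement are the required
  embeddings.\<close>

lemma shuffle_subset:
  assumes "S \<subseteq> {..<N}"
  obtains e1 e2 where "shuffle (card S) (N - card S) e1 e2" "e1 ` {..<card S} = S"
proof
  let ?e = "\<lambda>S i. sorted_list_of_set (S :: nat set) ! i"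
  have fin: "finite S" "finite ({..<N} - S)"
    using assms by (auto intro: finite_subset)
  have card: "card ({..<N} - S) = N - card S" "card S \<le> N"
    using assms card_mono[OF _ assms] by (simp_all add: card_Diff_subset fin)
  have image: "?e T ` {..<card T} = T" if "finite T" for T
    using that by (metis atLeast0LessThan length_sorted_list_of_set list.set_map map_nth set_sorted_list_of_set set_upt)
  have mono: "?e T i < ?e T j" if "i < j" "j < card T" for T i j
    using that by (simp add: sorted_wrt_nth_less)
  show "shuffle (card S) (N - card S) (?e S) (?e ({..<N} - S))"
  proof
    show "?e S i \<noteq> ?e ({..<N} - S) j" if "i < card S" "j < N - card S" for i j
      using that image[OF fin(1)] image[OF fin(2)] card(1) by (metis DiffD2 imageI lessThan_iff)
    show "?e S ` {..<card S} \<union> ?e ({..<N} - S) ` {..<N - card S} = {..<card S + (N - card S)}"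
      using image[OF fin(1)] image[OF fin(2)] card assms by auto
  qed (use mono card in auto)
  show "?e S ` {..<card S} = S"
    by (rule image[OF fin(1)])
qed

text \<open>The binomial coefficient counts the choices of the \<open>k\<close> companions of vertex
  0 among the remaining \<open>N\<close> vertices.\<close>

lemma sum_subsets_containing_0:
  fixes f :: "nat \<Rightarrow> 'a::semiring_1"
  shows "(\<Sum>S | S \<subseteq> {..<Suc N} \<and> 0 \<in> S. f (card S)) = (\<Sum>k\<le>N. of_nat (N choose k) * f (Suc k))"
proof -
  have "(\<Sum>S | S \<subseteq> {..<Suc N} \<and> 0 \<in> S. f (card S)) = (\<Sum>T\<in>Pow {1..<Suc N}. f (Suc (card T)))"
  proof (rule sum.reindex_bij_witness[of _ "insert 0" "\<lambda>S. S - {0}"])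
    fix S assume S: "S \<in> {S. S \<subseteq> {..<Suc N} \<and> 0 \<in> S}"
    then have "finite S"
      by (auto intro: finite_subset)
    then show "f (Suc (card (S - {0}))) = f (card S)"
      using S by (metis (no_types, lifting) card_Suc_Diff1 mem_Collect_eq)
    show "S - {0} \<in> Pow {1..<Suc N}"
      using S by (auto simp: Suc_le_eq)
  qed auto
  also have "\<dots> = (\<Sum>k\<le>N. \<Sum>T | T \<in> Pow {1..<Suc N} \<and> card T = k. f (Suc (card T)))"
  proof (rule sum.group[symmetric])
    have "card T \<le> N" if "T \<in> Pow {1..<Suc N}" for T
      using card_mono[of "{1..<Suc N}" T] that by simp
    then show "card ` Pow {1..<Suc N} \<subseteq> {..N}"
      by blast
  qed auto
  also have "\<dots> = (\<Sum>k\<le>N. of_nat (N choose k) * f (Suc k))"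
    using n_subsets[of "{1..<Suc N}"] by (intro sum.cong) simp_all
  finally show ?thesis .
qed

lemma diagrams_0: "diagrams L 0 = {([], {})}"
  by (auto simp: diagrams_def complete_contraction_def legs_def)

lemma connected_diagrams_0: "connected_diagrams L 0 = {}"
  by (auto simp: connected_diagrams_def connected_diagram_def diagrams_def)

lemma diagrams_iff:
  "D \<in> diagrams L n \<longleftrightarrow> length (fst D) = n \<and> (\<forall>v<n. L (fst D ! v) \<noteq> 0) \<and> complete_contraction (fst D) (snd D)"
  by (auto simp: diagrams_def all_set_conv_all_nth)

lemma finite_diagrams:
  assumes "finite {w. L w \<noteq> 0}"
  shows "finite (diagrams L n)"
proof (rule finite_subset)
  let ?W = "{ws. set ws \<subseteq> {w. L w \<noteq> 0} \<and> length ws = n}"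
  show "diagrams L n \<subseteq> (SIGMA ws:?W. Pow (legs ws \<times> legs ws))"
    by (auto simp: diagrams_def complete_contraction_def)
  show "finite (SIGMA ws:?W. Pow (legs ws \<times> legs ws))"
    using finite_lists_length_eq[OF assms] by (intro finite_SigmaI) auto
qed

lemma component_subset:
  assumes "D \<in> diagrams L n" "n > 0"
  shows "{v. (0, v) \<in> (adjacent D)\<^sup>*} \<subseteq> {..<n}"
proof -
  have complete: "complete_contraction (fst D) (snd D)" and len: "length (fst D) = n"
    using assms(1) by (simp_all add: diagrams_iff)
  have edge: "w < n" if "(v, w) \<in> adjacent D" for v w
    using complete_contraction_line(1,2)[OF complete] that len by (auto simp: adjacent_def legs_def)
  have "v < n" if "(0, v) \<in> (adjacent D)\<^sup>*" for v
    using that by (cases rule: rtrancl.cases) (use assms(2) edge in auto)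
  then show ?thesis
    by blast
qed

lemma integrand_diagram:
  assumes "D \<in> diagrams L n"
  shows "integrand_fps n (diagram_integrand g L D)"
  unfolding integrand_fps_def
proof (intro allI impI)
  fix x y :: "nat \<Rightarrow> pt" assume eq: "\<forall>v<n. x v = y v"
  have len: "length (fst D) = n"
    using assms by (auto simp: diagrams_def)
  have complete: "complete_contraction (fst D) (snd D)"
    using assms by (simp add: diagrams_iff)
  have "x (fst l) = y (fst l) \<and> x (fst k) = y (fst k)" if "(l, k) \<in> snd D" for l k
    using complete_contraction_line(1,2)[OF complete that] eq len by (auto simp: legs_def)
  then have "(\<Prod>(l, k)\<in>snd D. contraction g (jet_at (fst D) l) (jet_at (fst D) k) (x (fst l)) (x (fst k))) =
     (\<Prod>(l, k)\<in>snd D. contraction g (jet_at (fst D) l) (jet_at (fst D) k) (y (fst l)) (y (fst k)))"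
    by (intro prod.cong) auto
  then show "diagram_integrand g L D x = diagram_integrand g L D y"
    using eq unfolding diagram_integrand_def len by simp
qed

context shuffle
begin

lemma merge_diagrams_iff:
  assumes "merges D1 D2 D"
  shows "D \<in> diagrams L (m + n) \<longleftrightarrow> D1 \<in> diagrams L m \<and> D2 \<in> diagrams L n"
proof -
  interpret s: shuffle n m e2 e1 by (rule swap)
  note swapped = merges_swap[OF assms]
  have "(\<forall>v<m + n. L (fst D ! v) \<noteq> 0) \<longleftrightarrow> (\<forall>v\<in>e1 ` {..<m} \<union> e2 ` {..<n}. L (fst D ! v) \<noteq> 0)"
    unfolding cover by auto
  also have "\<dots> \<longleftrightarrow> (\<forall>v<m. L (fst D1 ! v) \<noteq> 0) \<and> (\<forall>v<n. L (fst D2 ! v) \<noteq> 0)"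
    by (simp add: ball_Un words[OF assms] s.words[OF swapped]) (simp add: Ball_def)
  finally show ?thesis
    unfolding diagrams_iff using lengths[OF assms] complete_merge[OF assms]
      complete_restrict1[OF assms] s.complete_restrict1[OF swapped] by auto
qed

text \<open>Cutting and joining are inverse bijections between the diagrams whose component of 0 is
  exactly the image of \<open>e1\<close> and the pairs of a connected diagram and an arbitrary
  one.\<close>

lemma sum_component:
  fixes h :: "diagram \<Rightarrow> 'a::comm_ring"
  assumes "0 \<in> e1 ` {..<m}"
    and h: "\<And>D1 D2 D. merges D1 D2 D \<Longrightarrow> D1 \<in> diagrams L m \<Longrightarrow> D2 \<in> diagrams L n \<Longrightarrow> h D = h D1 * h D2"
  shows "(\<Sum>D | D \<in> diagrams L (m + n) \<and> {v. (0, v) \<in> (adjacent D)\<^sup>*} = e1 ` {..<m}. h D) =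
    (\<Sum>D\<in>connected_diagrams L m. h D) * (\<Sum>D\<in>diagrams L n. h D)" (is "sum h ?A = _")
proof -
  interpret s: shuffle n m e2 e1 by (rule swap)
  have join: "merges D1 D2 (join D1 D2)" if "D1 \<in> diagrams L m" "D2 \<in> diagrams L n" for D1 D2
    using that by (intro merges_join) (auto simp: diagrams_def complete_contraction_def)
  have restrict: "merges (restrict_diagram e1 m D) (restrict_diagram e2 n D) D" if "D \<in> ?A" for D
  proof (rule merges_restrict)
    \<comment> \<open>A component is closed under adjacency, which is what cutting requires.\<close>
    show "w \<in> e1 ` {..<m}" if "(v, w) \<in> adjacent D" "v \<in> e1 ` {..<m}" for v w
    proof -
      have A: "{v. (0, v) \<in> (adjacent D)\<^sup>*} = e1 ` {..<m}"
        using \<open>D \<in> ?A\<close> by blast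
      show ?thesis
        using that unfolding A[symmetric] by (simp add: rtrancl.rtrancl_into_rtrancl)
    qed
  qed (use that in \<open>auto simp: diagrams_iff complete_contraction_def\<close>)
  have "sum h ?A = (\<Sum>(D1, D2)\<in>connected_diagrams L m \<times> diagrams L n. h D1 * h D2)"
  proof (rule sum.reindex_bij_witness[of _ "\<lambda>(D1, D2). join D1 D2" "\<lambda>D. (restrict_diagram e1 m D, restrict_diagram e2 n D)"])
    fix D assume D: "D \<in> ?A"
    note merges = restrict[OF D]
    have mem: "restrict_diagram e1 m D \<in> diagrams L m" "restrict_diagram e2 n D \<in> diagrams L n"
      using D merge_diagrams_iff[OF merges] by auto
    show "(case (restrict_diagram e1 m D, restrict_diagram e2 n D) of (D1, D2) \<Rightarrow> join D1 D2) = D"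
      using merges_unique[OF join[OF mem] merges] by simp
    show "(restrict_diagram e1 m D, restrict_diagram e2 n D) \<in> connected_diagrams L m \<times> diagrams L n"
      using mem D connected_merge[OF merges assms(1)] by (simp add: connected_diagrams_def)
    show "(case (restrict_diagram e1 m D, restrict_diagram e2 n D) of (D1, D2) \<Rightarrow> h D1 * h D2) = h D"
      using h[OF merges mem] by simp
  next
    fix p assume "p \<in> connected_diagrams L m \<times> diagrams L n"
    then obtain D1 D2 where p: "p = (D1, D2)" "D1 \<in> diagrams L m" "connected_diagram D1" "D2 \<in> diagrams L n"
      by (auto simp: connected_diagrams_def)
    note merges = join[OF p(2,4)]
    show "(restrict_diagram e1 m (case p of (D1, D2) \<Rightarrow> join D1 D2),
        restrict_diagram e2 n (case p of (D1, D2) \<Rightarrow> join D1 D2)) = p"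
      using restrict_merge[OF merges] s.restrict_merge[OF merges_swap[OF merges]] p(1) by simp
    show "(case p of (D1, D2) \<Rightarrow> join D1 D2) \<in> ?A"
      using merge_diagrams_iff[OF merges] connected_merge[OF merges assms(1)] p by simp
  qed
  also have "\<dots> = (\<Sum>D\<in>connected_diagrams L m. h D) * (\<Sum>D\<in>diagrams L n. h D)"
    by (simp add: sum_product sum.cartesian_product)
  finally show ?thesis .
qed

end

context formal_integration
begin

text \<open>The number of integration variables is read off the diagram, so that the same function
  is multiplicative at all orders.\<close>

definition weight :: "real \<Rightarrow> density \<Rightarrow> diagram \<Rightarrow> complex fps" where
  "weight g L D = integrate I (length (fst D)) (diagram_integrand g L D)"

lemma weight_merge:
  assumes "shuffle m n e1 e2" "shuffle.merges m n e1 e2 D1 D2 D" "D1 \<in> diagrams L m" "D2 \<in> diagrams L n"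
    and even: "\<And>w. L w \<noteq> 0 \<Longrightarrow> even_ghosts w"
  shows "weight g L D = weight g L D1 * weight g L D2"
proof -
  interpret shuffle m n e1 e2 by fact
  have "diagram_integrand g L D = (\<lambda>x. diagram_integrand g L D1 (x \<circ> e1) * diagram_integrand g L D2 (x \<circ> e2))"
    using assms by (intro ext integrand_merge) (auto simp: diagrams_def)
  then show ?thesis
    using integrate_shuffle[OF assms(1) integrand_diagram[OF assms(3)] integrand_diagram[OF assms(4)]]
      lengths[OF assms(2)] by (simp add: weight_def)
qed

text \<open>Diagrams are sorted by the component of vertex 0. The contribution of a vertex set
  depends only on its size, because the remaining diagrams can be renumbered.\<close>

lemma sum_diagrams_Suc:
  assumes "finite {w. L w \<noteq> 0}" and even: "\<And>w. L w \<noteq> 0 \<Longrightarrow> even_ghosts w"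
  shows "(\<Sum>D\<in>diagrams L (Suc N). weight g L D) = (\<Sum>k\<le>N. of_nat (N choose k) *
    ((\<Sum>D\<in>connected_diagrams L (Suc k). weight g L D) * (\<Sum>D\<in>diagrams L (N - k). weight g L D)))"
proof -
  let ?c = "\<lambda>D. {v. (0, v) \<in> (adjacent D)\<^sup>*}"
  let ?SS = "{S. S \<subseteq> {..<Suc N} \<and> (0::nat) \<in> S}"
  have "(\<Sum>D\<in>diagrams L (Suc N). weight g L D) = (\<Sum>S\<in>?SS. \<Sum>D | D \<in> diagrams L (Suc N) \<and> ?c D = S. weight g L D)"
  proof (rule sum.group[symmetric])
    show "?c ` diagrams L (Suc N) \<subseteq> ?SS"
    proof (rule image_subsetI)
      fix D assume "D \<in> diagrams L (Suc N)"
      then show "?c D \<in> ?SS"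
        using component_subset[of D L "Suc N"] by simp
    qed
  qed (simp_all add: finite_diagrams[OF assms(1)])
  also have "\<dots> = (\<Sum>S\<in>?SS. (\<Sum>D\<in>connected_diagrams L (card S). weight g L D) * (\<Sum>D\<in>diagrams L (Suc N - card S). weight g L D))"
  proof (rule sum.cong)
    fix S assume S: "S \<in> ?SS"
    then obtain e1 e2 where e: "shuffle (card S) (Suc N - card S) e1 e2" "e1 ` {..<card S} = S"
      using shuffle_subset[of S "Suc N"] by blast
    have "card S + (Suc N - card S) = Suc N"
      using S card_mono[of "{..<Suc N}" S] by auto
    then show "(\<Sum>D | D \<in> diagrams L (Suc N) \<and> ?c D = S. weight g L D) =
        (\<Sum>D\<in>connected_diagrams L (card S). weight g L D) * (\<Sum>D\<in>diagrams L (Suc N - card S). weight g L D)"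
      using shuffle.sum_component[OF e(1), of L "weight g L"] weight_merge[OF e(1) _ _ _ even] S e(2) by simp
  qed simp
  finally show ?thesis
    using sum_subsets_containing_0[where N = N and f = "\<lambda>k. (\<Sum>D\<in>connected_diagrams L k. weight g L D) * (\<Sum>D\<in>diagrams L (Suc N - k). weight g L D)"]
    by simp
qed

lemma diagram_sum_nth:
  assumes "finite {w. L w \<noteq> 0}" "DD n \<subseteq> diagrams L n"
  shows "fps_nth (diagram_sum I g L DD) n = fps_const (\<i> ^ n / fact n) * (\<Sum>D\<in>DD n. weight g L D)"
proof -
  have "length (fst D) = n" if "D \<in> DD n" for D
    using that assms(2) by (auto simp: diagrams_def)
  then show ?thesis
    using assms finite_subset[OF assms(2) finite_diagrams[OF assms(1)]] integrand_diagram
    by (subst diagram_sum_def, subst fps_nth_Abs_fps, subst integrate_sum) (auto simp: weight_def)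
qed

lemma diagram_sum_0: "fps_nth (diagram_sum I g L (diagrams L)) 0 = 1"
proof -
  have "fermi_sign ([], {}) = 1"
    by (simp add: fermi_sign_def)
  then have "diagram_integrand g L ([], {}) = (\<lambda>x. 1)"
    by (intro ext) (simp add: diagram_integrand_def)
  then show ?thesis
    by (simp add: diagram_sum_def diagrams_0 integrate_def fps_eq_iff one zero)
qed

text \<open>The recursion over the component of a marked vertex, written for exponential generating
  functions: marking a vertex turns \<open>1 / fact n\<close> into the coefficient of a derivative.
  This is Z = exp W in differential form.\<close>

lemma linked_cluster_deriv:
  assumes "finite {w. L w \<noteq> 0}" "\<And>w. L w \<noteq> 0 \<Longrightarrow> even_ghosts w"
  shows "fps_deriv (diagram_sum I g L (diagrams L)) =
    fps_deriv (diagram_sum I g L (connected_diagrams L)) * diagram_sum I g L (diagrams L)"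
proof (rule fps_ext)
  fix N
  let ?a = "\<lambda>n. \<Sum>D\<in>diagrams L n. weight g L D" and ?c = "\<lambda>n. \<Sum>D\<in>connected_diagrams L n. weight g L D"
  have a: "fps_nth (diagram_sum I g L (diagrams L)) n = fps_const (\<i> ^ n / fact n) * ?a n" for n
    by (rule diagram_sum_nth[OF assms(1)]) simp
  have c: "fps_nth (diagram_sum I g L (connected_diagrams L)) n = fps_const (\<i> ^ n / fact n) * ?c n" for n
    by (rule diagram_sum_nth[OF assms(1)]) (auto simp: connected_diagrams_def)
  have coeff: "of_nat (Suc n) * (fps_const (\<i> ^ Suc n / fact (Suc n)) * x) = fps_const (\<i> ^ Suc n / fact n) * x"
    for n and x :: "complex fps"
  proof -
    have "of_nat (Suc n) * fps_const (\<i> ^ Suc n / fact (Suc n)) = fps_const (\<i> ^ Suc n / fact n :: complex)"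
      by (simp del: of_nat_Suc power_Suc add: fps_of_nat[symmetric])
    then show ?thesis
      by (metis mult.assoc)
  qed
  have rec: "?a (Suc N) = (\<Sum>k\<le>N. of_nat (N choose k) * (?c (Suc k) * ?a (N - k)))"
    using assms by (rule sum_diagrams_Suc)
  have "fps_nth (fps_deriv (diagram_sum I g L (diagrams L))) N = fps_const (\<i> ^ Suc N / fact N) * ?a (Suc N)"
    using coeff by (simp add: a)
  also have "\<dots> = (\<Sum>k\<le>N. fps_const (\<i> ^ Suc k / fact k) * ?c (Suc k) * (fps_const (\<i> ^ (N - k) / fact (N - k)) * ?a (N - k)))"
    unfolding rec sum_distrib_left[where A = "{..N}"]
  proof (rule sum.cong)
    fix k assume "k \<in> {..N}"
    \<comment> \<open>The binomial coefficient divided by \<open>fact N\<close> splits into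
      \<open>1 / fact k\<close> and \<open>1 / fact (N - k)\<close>, and the powers of
      \<open>\<i>\<close> add up.\<close>
    then have "fps_const (\<i> ^ Suc N / fact N) * of_nat (N choose k) =
        fps_const (\<i> ^ Suc k / fact k) * fps_const (\<i> ^ (N - k) / fact (N - k) :: complex)"
      by (simp add: binomial_fact fps_of_nat[symmetric] power_add[symmetric])
    then show "fps_const (\<i> ^ Suc N / fact N) * (of_nat (N choose k) * (?c (Suc k) * ?a (N - k))) =
        fps_const (\<i> ^ Suc k / fact k) * ?c (Suc k) * (fps_const (\<i> ^ (N - k) / fact (N - k)) * ?a (N - k))"
      by (simp add: mult_ac)
  qed simp
  also have "\<dots> = fps_nth (fps_deriv (diagram_sum I g L (connected_diagrams L)) * diagram_sum I g L (diagrams L)) N"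
    by (simp add: fps_mult_nth a c coeff atLeast0AtMost del: of_nat_Suc power_Suc fact_Suc)
  finally show "fps_nth (fps_deriv (diagram_sum I g L (diagrams L))) N =
      fps_nth (fps_deriv (diagram_sum I g L (connected_diagrams L)) * diagram_sum I g L (diagrams L)) N" .
qed


lemma connected_sum_0:
  assumes "finite {w. L w \<noteq> 0}"
  shows "fps_nth (diagram_sum I g L (connected_diagrams L)) 0 = 0"
  using assms by (subst diagram_sum_nth) (auto simp: connected_diagrams_0)

end

section \<open>Exponential and logarithm of perturbative series\<close>

lemma fps_linear_ode_unique:
  fixes F G :: "'a::{idom,semiring_char_0} fps"
  assumes "fps_deriv F = P * F" "fps_deriv G = P * G" "fps_nth F 0 = fps_nth G 0"
  shows "F = G"
proof (rule fps_ext)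
  show "fps_nth F n = fps_nth G n" for n
  proof (induction n rule: less_induct)
    case (less n)
    show ?case
    proof (cases n)
      case (Suc k)
      have "fps_nth (P * F) k = fps_nth (P * G) k"
        unfolding fps_mult_nth using less Suc by (intro sum.cong) auto
      \<comment> \<open>The coefficients lie in a domain of characteristic 0 that need not be a
        field, so the factor is cancelled instead of divided out.\<close>
      then have "of_nat (Suc k) * fps_nth F (Suc k) = of_nat (Suc k) * fps_nth G (Suc k)"
        unfolding assms(1,2)[symmetric] by simp
      then show ?thesis
        using Suc by (simp del: of_nat_Suc)
    qed (use assms in simp)
  qed
qed

text \<open>Both series solve F' = W' F with constant term 1.\<close>

lemma pert_exp_eqI:
  assumes "fps_deriv Z = fps_deriv W * Z" "fps_nth W 0 = 0" "fps_nth Z 0 = 1"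
  shows "pert_exp W = Z"
proof (rule fps_linear_ode_unique)
  define E :: pert_series where "E = Abs_fps (\<lambda>k. fps_const (fps_nth (fps_exp 1) k))"
  have exp: "pert_exp W = E oo W"
    by (simp add: pert_exp_def E_def)
  have "fps_deriv E = E"
  proof (rule fps_ext)
    fix n
    have "of_nat (Suc n) * fps_const (1 / fact (Suc n)) = fps_const (1 / fact n :: complex)"
      by (simp del: of_nat_Suc add: fps_of_nat[symmetric])
    then show "fps_nth (fps_deriv E) n = fps_nth E n"
      by (simp add: E_def)
  qed
  then show "fps_deriv (pert_exp W) = fps_deriv W * pert_exp W"
    using fps_compose_deriv[OF assms(2), of E] by (simp add: exp)
  show "fps_nth (pert_exp W) 0 = fps_nth Z 0"
    using assms(3) by (simp add: exp E_def)
qed (use assms in simp)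

lemma pert_ln_eqI:
  assumes "fps_deriv Z = fps_deriv W * Z" "fps_nth W 0 = 0" "fps_nth Z 0 = 1"
  shows "pert_ln Z = W"
proof -
  define L :: pert_series where "L = Abs_fps (\<lambda>k. fps_const (fps_nth (fps_ln 1) k))"
  have ln: "pert_ln Z = L oo (Z - 1)"
    by (simp add: pert_ln_def L_def)
  have Z: "fps_nth (Z - 1) 0 = 0"
    using assms(3) by simp
  \<comment> \<open>The derivative of the logarithm series is the alternating geometric series;
    substituting Z - 1 turns this into the inverse of Z.\<close>
  have "fps_deriv L * (1 + fps_X) = 1"
  proof (rule fps_ext)
    fix n
    have L: "fps_nth (fps_deriv L) n = (- 1) ^ n" for n
    proof -
      have "of_nat (Suc n) * fps_const ((- 1) ^ n / of_nat (Suc n)) = fps_const ((- 1) ^ n :: complex)"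
        by (simp del: of_nat_Suc add: fps_of_nat[symmetric])
      then show ?thesis
        by (simp add: L_def fps_ln_def flip: fps_const_power fps_const_neg)
    qed
    show "fps_nth (fps_deriv L * (1 + fps_X)) n = fps_nth 1 n"
      unfolding distrib_left by (cases n) (simp_all add: L del: fps_deriv_nth)
  qed
  then have "(fps_deriv L * (1 + fps_X)) oo (Z - 1) = 1"
    by simp
  then have inv: "(fps_deriv L oo (Z - 1)) * Z = 1"
    by (simp add: fps_compose_mult_distrib[OF Z] fps_compose_add_distrib fps_X_fps_compose_startby0[OF Z])
  have "fps_deriv (pert_ln Z) * Z = fps_deriv W * Z"
    unfolding ln fps_compose_deriv[OF Z] using inv assms(1) by (simp add: ac_simps)
  \<comment> \<open>Z can be cancelled: its constant term is 1 and there are no zero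
    divisors.\<close>
  then have "fps_deriv (pert_ln Z) = fps_deriv W"
    using assms(3) by auto
  then show ?thesis
    using assms(2) by (simp add: fps_deriv_eq_iff ln L_def fps_ln_def)
qed

context formal_integration
begin

theorem linked_cluster:
  assumes "finite {w. L w \<noteq> 0}" "\<And>w. L w \<noteq> 0 \<Longrightarrow> even_ghosts w"
  shows "pert_exp (diagram_sum I g L (connected_diagrams L)) = diagram_sum I g L (diagrams L)"
    and "pert_ln (diagram_sum I g L (diagrams L)) = diagram_sum I g L (connected_diagrams L)"
  using linked_cluster_deriv[of L g, OF assms] connected_sum_0[OF assms(1)] diagram_sum_0
  by (auto intro: pert_exp_eqI pert_ln_eqI)

end

section \<open>Densities as sums of monomials\<close>

text \<open>Normal form of the actions: with all products expanded, charge, length and ghost parity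
  can be read off word by word.\<close>

definition monomial :: "(pt \<Rightarrow> real fps) \<Rightarrow> jet list \<Rightarrow> density" where
  "monomial f w = (\<lambda>w' x. if w' = w then f x else 0)"

lemma qf_monomial: "qf \<phi> = monomial (\<lambda>_. 1) [Jet [] \<phi>]"
  by (simp add: qf_def monomial_def)

lemma dqf_monomial: "dqf \<mu> \<phi> = monomial (\<lambda>_. 1) [Jet [\<mu>] \<phi>]"
  by (simp add: dqf_def monomial_def)

lemma bg_monomial: "bg f = monomial f []"
  by (simp add: bg_def monomial_def)

lemma dscale_monomial: "r \<odot> monomial f w = monomial (\<lambda>x. fps_const r * f x) w"
  by (intro ext) (simp add: dscale_def monomial_def)

lemma dmul_monomial: "monomial f u \<star> monomial h v = monomial (\<lambda>x. f x * h x) (u @ v)"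
proof (intro ext)
  fix w x
  \<comment> \<open>Only the cut after \<open>length u\<close> letters can give \<open>u\<close> and
    \<open>v\<close>, so a single term of the convolution survives.\<close>
  have split: "take k w = u \<and> drop k w = v \<longleftrightarrow> k = length u \<and> w = u @ v" if "k \<le> length w" for k
    using that by (metis append_eq_conv_conj append_take_drop_id length_take min.absorb2)
  have "(monomial f u \<star> monomial h v) w x =
      (\<Sum>k\<le>length w. if k = length u then if w = u @ v then f x * h x else 0 else 0)"
    unfolding dmul_def monomial_def
  proof (intro sum.cong refl)
    fix k assume "k \<in> {..length w}"
    then have "take k w = u \<and> drop k w = v \<longleftrightarrow> k = length u \<and> w = u @ v"
      using split by simp
    then show "(if take k w = u then f x else 0) * (if drop k w = v then h x else 0) =
        (if k = length u then if w = u @ v then f x * h x else 0 else 0)"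
      by (cases "take k w = u"; cases "drop k w = v"; cases "k = length u"; simp only: if_True if_False simp_thms mult_zero_left mult_zero_right refl)
  qed
  also have "\<dots> = monomial (\<lambda>x. f x * h x) (u @ v) w x"
    by (subst sum.delta) (auto simp: monomial_def)
  finally show "(monomial f u \<star> monomial h v) w x = monomial (\<lambda>x. f x * h x) (u @ v) w x" .
qed

lemma density_sum_apply: "(\<Sum>i\<in>A. (p i :: density)) w x = (\<Sum>i\<in>A. p i w x)"
  by (induction A rule: infinite_finite_induct) auto

lemma dscale_add: "r \<odot> (p + q) = r \<odot> p + r \<odot> q"
  by (intro ext) (simp add: dscale_def distrib_left)

lemma dscale_diff: "r \<odot> (p - q) = r \<odot> p - r \<odot> q"
  by (intro ext) (simp add: dscale_def right_diff_distrib)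

lemma dscale_sum: "r \<odot> (\<Sum>i\<in>A. p i) = (\<Sum>i\<in>A. r \<odot> p i)"
  by (intro ext) (simp add: dscale_def density_sum_apply sum_distrib_left)

lemma dscale_dscale: "r \<odot> s \<odot> p = (r * s) \<odot> p"
  by (intro ext) (simp add: dscale_def mult.assoc flip: fps_const_mult)

lemma dmul_add_right: "p \<star> (q + r) = p \<star> q + p \<star> r"
  by (intro ext) (simp add: dmul_def distrib_left sum.distrib)

lemma dmul_diff_right: "p \<star> (q - r) = p \<star> q - p \<star> r"
  by (intro ext) (simp add: dmul_def right_diff_distrib sum_subtractf)

lemma dmul_sum_right: "p \<star> (\<Sum>i\<in>A. q i) = (\<Sum>i\<in>A. p \<star> q i)"
proof (intro ext)
  fix w x
  show "(p \<star> (\<Sum>i\<in>A. q i)) w x = (\<Sum>i\<in>A. p \<star> q i) w x"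
    unfolding dmul_def density_sum_apply sum_distrib_left by (rule sum.swap)
qed

lemma dmul_dscale_right: "p \<star> (r \<odot> q) = r \<odot> (p \<star> q)"
  by (intro ext) (simp add: dmul_def dscale_def sum_distrib_left mult_ac)

lemma dmul_dscale_left: "(r \<odot> p) \<star> q = r \<odot> (p \<star> q)"
  by (intro ext) (simp add: dmul_def dscale_def sum_distrib_left mult_ac)

lemmas density_linear = dscale_add dscale_diff dscale_sum dmul_add_right dmul_diff_right
  dmul_sum_right dmul_dscale_right dmul_dscale_left

lemmas density_monomial = qf_monomial dqf_monomial bg_monomial dscale_monomial dmul_monomial

text \<open>An upper bound for the words that occur: coefficients such as \<open>eps\<close> may
  vanish, and terms may cancel.\<close>

definition supported :: "density \<Rightarrow> (jet list \<Rightarrow> bool) \<Rightarrow> bool" where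
  "supported p Q \<longleftrightarrow> (\<forall>w. p w \<noteq> 0 \<longrightarrow> Q w)"

lemma supportedD: "supported p Q \<Longrightarrow> p w \<noteq> 0 \<Longrightarrow> Q w"
  by (simp add: supported_def)

lemma supported_monomial: "Q w \<Longrightarrow> supported (monomial f w) Q"
  by (auto simp: supported_def monomial_def fun_eq_iff)

lemma supported_add: "supported p Q \<Longrightarrow> supported q Q \<Longrightarrow> supported (p + q) Q"
  by (force simp: supported_def)

lemma supported_diff: "supported p Q \<Longrightarrow> supported q Q \<Longrightarrow> supported (p - q) Q"
  by (force simp: supported_def)

lemma supported_uminus: "supported p Q \<Longrightarrow> supported (- p) Q"
  by (force simp: supported_def)

lemma supported_sum: "(\<And>i. i \<in> A \<Longrightarrow> supported (p i) Q) \<Longrightarrow> supported (\<Sum>i\<in>A. p i) Q"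
  by (induction A rule: infinite_finite_induct) (auto intro: supported_add simp: supported_def[of 0])

lemma supported_weaken: "supported p Q \<Longrightarrow> (\<And>w. Q w \<Longrightarrow> R w) \<Longrightarrow> supported p R"
  by (simp add: supported_def)

lemma supported_eq_0: "supported p Q \<Longrightarrow> \<not> Q w \<Longrightarrow> p w = 0"
  by (auto simp: supported_def)

lemmas supported_intros = supported_add supported_diff supported_uminus supported_sum supported_monomial

definition finite_support :: "density \<Rightarrow> bool" where
  "finite_support p \<longleftrightarrow> finite {w. p w \<noteq> 0}"

lemma finite_support_monomial: "finite_support (monomial f w)"
  unfolding finite_support_def by (rule finite_subset[of _ "{w}"]) (auto simp: monomial_def fun_eq_iff)

lemma finite_support_add: "finite_support p \<Longrightarrow> finite_support q \<Longrightarrow> finite_support (p + q)"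
  unfolding finite_support_def by (rule finite_subset[of _ "{w. p w \<noteq> 0} \<union> {w. q w \<noteq> 0}"]) auto

lemma finite_support_uminus: "finite_support p \<Longrightarrow> finite_support (- p)"
  by (simp add: finite_support_def)

lemma finite_support_diff: "finite_support p \<Longrightarrow> finite_support q \<Longrightarrow> finite_support (p - q)"
  using finite_support_add[of p "- q"] finite_support_uminus[of q] by simp

lemma finite_support_sum: "(\<And>i. i \<in> A \<Longrightarrow> finite_support (p i)) \<Longrightarrow> finite_support (\<Sum>i\<in>A. p i)"
  by (induction A rule: infinite_finite_induct) (auto intro: finite_support_add simp: finite_support_def[of 0])

lemmas finite_support_intros = finite_support_add finite_support_diff finite_support_uminus
  finite_support_sum finite_support_monomial


section \<open>The charge selection rule\<close>

text \<open>\<open>M\<close> has to compensate its partner \<open>A\<close>, whereas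
  \<open>N\<close> can stay at 0 because its only partner \<open>B\<close> is already
  negative.\<close>

fun charge :: "field \<Rightarrow> int" where
  "charge (FA a \<mu>) = 1" | "charge (FB a \<mu>) = - 1" | "charge (FM a) = - 1" | "charge (FN a) = 0"
| "charge (FC a) = 2" | "charge (FCbar a) = - 2" | "charge (FXi a) = 0" | "charge (FXibar a) = 0"

definition word_charge :: "jet list \<Rightarrow> int" where
  "word_charge w = (\<Sum>j\<leftarrow>w. charge (fld j))"

lemma contractible_charge: "contractible p q \<Longrightarrow> charge p + charge q \<le> 0"
  by (cases p; cases q; simp)

text \<open>Summed over vertices, the charges of all legs give a nonnegative number; summed over
  lines, a nonpositive one. The total is therefore 0, and so is each of its nonnegative
  terms.\<close>

lemma neutral_vertices:
  assumes "D \<in> diagrams L n" "\<And>w. L w \<noteq> 0 \<Longrightarrow> 0 \<le> word_charge w" "w \<in> set (fst D)"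
  shows "word_charge w = 0"
proof -
  let ?q = "\<lambda>l. charge (fld (jet_at (fst D) l))"
  have complete: "complete_contraction (fst D) (snd D)"
    and nonneg: "\<And>w. w \<in> set (fst D) \<Longrightarrow> 0 \<le> word_charge w"
    using assms(1,2) by (auto simp: diagrams_def)
  have word: "word_charge (fst D ! v) = (\<Sum>i<length (fst D ! v). ?q (v, i))" for v
    by (simp add: word_charge_def sum_list_sum_nth jet_at_def atLeast0LessThan)
  have "(\<Sum>v<length (fst D). word_charge (fst D ! v)) = (\<Sum>l\<in>legs (fst D). ?q l)"
    by (simp add: sum_legs word)
  also have "\<dots> = (\<Sum>e\<in>snd D. ?q (fst e) + ?q (snd e))"
    by (rule complete_contraction_sum[OF complete])
  also have "\<dots> \<le> 0"
    using complete_contraction_line(4)[OF complete] by (intro sum_nonpos contractible_charge) auto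
  finally have "(\<Sum>v<length (fst D). word_charge (fst D ! v)) = 0"
    using nonneg by (intro antisym sum_nonneg) auto
  then have "\<forall>v<length (fst D). word_charge (fst D ! v) = 0"
    using nonneg by (subst (asm) sum_nonneg_eq_0_iff) auto
  then show ?thesis
    using assms(3) by (metis in_set_conv_nth)
qed

context
  fixes L L' :: density
  assumes nonneg: "supported L (\<lambda>w. 0 \<le> word_charge w)" "supported L' (\<lambda>w. 0 \<le> word_charge w)"
    and neutral: "\<And>w. word_charge w = 0 \<Longrightarrow> L w = L' w"
begin

text \<open>Complete contractions see such a density only through its neutral words.\<close>

lemma diagrams_neutral_eq: "diagrams L n = diagrams L' n"
proof (intro set_eqI iffI)
  have mem: "D \<in> diagrams M n \<longleftrightarrow>
      length (fst D) = n \<and> (\<forall>w\<in>set (fst D). M w \<noteq> 0) \<and> complete_contraction (fst D) (snd D)" for D M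
    by (simp add: diagrams_def case_prod_unfold)
  fix D
  show "D \<in> diagrams L' n" if "D \<in> diagrams L n"
  proof -
    have "L w = L' w" if "w \<in> set (fst D)" for w
      using neutral_vertices[OF \<open>D \<in> diagrams L n\<close> supportedD[OF nonneg(1)] that] neutral by simp
    then show ?thesis
      using that by (simp add: mem)
  qed
  show "D \<in> diagrams L n" if "D \<in> diagrams L' n"
  proof -
    have "L w = L' w" if "w \<in> set (fst D)" for w
      using neutral_vertices[OF \<open>D \<in> diagrams L' n\<close> supportedD[OF nonneg(2)] that] neutral by simp
    then show ?thesis
      using that by (simp add: mem)
  qed
qed

lemma integrand_neutral_eq:
  assumes "D \<in> diagrams L n"
  shows "diagram_integrand g L D = diagram_integrand g L' D"
proof -
  have "L (fst D ! v) = L' (fst D ! v)" if "v < length (fst D)" for v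
    using neutral_vertices[OF assms supportedD[OF nonneg(1)] nth_mem[OF that]] neutral by simp
  then show ?thesis
    by (intro ext) (simp add: diagram_integrand_def)
qed

lemma diagram_sum_neutral_eq:
  assumes "\<And>n. DD n \<subseteq> diagrams L n"
  shows "diagram_sum I g L DD = diagram_sum I g L' DD"
proof -
  have "(\<lambda>x. \<Sum>D\<in>DD n. diagram_integrand g L D x) = (\<lambda>x. \<Sum>D\<in>DD n. diagram_integrand g L' D x)" for n
    using assms integrand_neutral_eq by (intro ext sum.cong refl) (metis subsetD)
  then show ?thesis
    by (simp add: diagram_sum_def)
qed

end


section \<open>The vertices of the theory\<close>

text \<open>The quadratic words have to be removed, since they reach charge 0 and even -1 (the term
  with \<open>N\<close> and a derivative of \<open>B\<close>); positivity is claimed only for the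
  other lengths.\<close>

lemma interaction_charge: "supported (L_TOT g - L_free g) (\<lambda>w. 0 < word_charge w)"
proof -
  have "supported (L_TOT g) (\<lambda>w. length w \<noteq> 2 \<longrightarrow> 0 < word_charge w)"
    unfolding L_TOT_def L_S_def L_gauge_fixing_def curvature_def
    by (simp only: density_linear density_monomial append.simps)
      (intro supported_intros; simp add: word_charge_def)
  then show ?thesis
    by (auto simp: supported_def L_free_def)
qed

text \<open>All these words have charge 2: either \<open>Bh\<close> has replaced the only factor of
  negative charge, or the vertex stems from the cubic term in \<open>A\<close>.\<close>

definition L_rest :: "real \<Rightarrow> classical \<Rightarrow> classical \<Rightarrow> density" where
  "L_rest g Ah Bh =
     - (\<Sum>\<mu>\<in>UNIV. \<Sum>\<nu>\<in>UNIV. \<Sum>l\<in>UNIV. \<Sum>a\<in>UNIV. \<Sum>b\<in>UNIV. \<Sum>c\<in>UNIV.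
          (eps \<mu> \<nu> l * eps a b c) \<odot>
            ((1/2) \<odot> bg (Bh a \<mu>) \<star> qf (FA b \<nu>) \<star> qf (FA c l)
             + (g/2) \<odot> qf (FA a \<mu>) \<star> bg (Ah b \<nu>) \<star> qf (FA c l)))
     - (\<Sum>\<mu>\<in>UNIV. \<Sum>a\<in>UNIV. \<Sum>b\<in>UNIV. \<Sum>c\<in>UNIV. eps a b c \<odot>
          (dqf \<mu> (FXibar a) \<star> bg (Bh b \<mu>) \<star> qf (FC c)))"

lemma rest_charge: "supported (L_rest g Ah Bh) (\<lambda>w. 0 < word_charge w)"
  unfolding L_rest_def
  by (simp only: density_linear density_monomial append.simps)
    (intro supported_intros; simp add: word_charge_def)

text \<open>Charge 0 lets these vertices survive the selection rule, length 2 fixes the loop number,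
  and ghost parity makes the Fermi sign multiplicative.\<close>

lemma one_loop_vertices:
  "supported (L_one_loop Ah) (\<lambda>w. length w = 2 \<and> word_charge w = 0 \<and> even_ghosts w)"
proof -
  have [simp]: "{i. i < Suc (Suc 0) \<and> ghost (fld ([p, q] ! i))} =
      (if ghost (fld p) then {0} else {}) \<union> (if ghost (fld q) then {1} else {})" for p q
    by (auto simp: less_Suc_eq nth_Cons' split: if_splits)
  show ?thesis
    unfolding L_one_loop_def
    by (simp only: density_linear density_monomial append.simps)
      (intro supported_intros; simp add: word_charge_def even_ghosts_def)
qed

lemma finite_support_one_loop: "finite_support (L_one_loop Ah)"
  unfolding L_one_loop_def
  by (simp only: density_linear density_monomial append.simps) (intro finite_support_intros)

lemma sum_swap_4:
  "(\<Sum>l\<in>A. \<Sum>a\<in>B. \<Sum>b\<in>C. \<Sum>c\<in>E. f l a b c) = (\<Sum>a\<in>B. \<Sum>b\<in>C. \<Sum>c\<in>E. \<Sum>l\<in>A. f l a b c)"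
  by (subst sum.swap, rule sum.cong[OF refl], subst sum.swap, rule sum.cong[OF refl], rule sum.swap)

text \<open>Apart from a regrouping of terms, the two sides differ only in the order of vector and
  colour sums; each use of \<open>sum_swap_4\<close> moves one vector index past the three colour
  indices.\<close>

lemma L_tilde_decomposition: "L_tilde g Ah Bh = L_TOT g + L_one_loop Ah + L_rest g Ah Bh"
proof -
  let ?BA = "\<lambda>\<mu> \<nu> l a b c. qf (FB a \<mu>) \<star> bg (Ah b \<nu>) \<star> qf (FA c l)"
  have "(\<Sum>\<mu>\<in>UNIV. \<Sum>\<nu>\<in>UNIV. \<Sum>l\<in>UNIV. \<Sum>a\<in>UNIV. \<Sum>b\<in>UNIV. \<Sum>c\<in>UNIV. (eps \<mu> \<nu> l * eps a b c) \<odot> ?BA \<mu> \<nu> l a b c)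
     = (\<Sum>\<mu>\<in>UNIV. \<Sum>\<nu>\<in>UNIV. \<Sum>a\<in>UNIV. \<Sum>b\<in>UNIV. \<Sum>c\<in>UNIV. \<Sum>l\<in>UNIV. (eps \<mu> \<nu> l * eps a b c) \<odot> ?BA \<mu> \<nu> l a b c)"
    by (intro sum.cong refl sum_swap_4)
  also have "\<dots> = (\<Sum>\<mu>\<in>UNIV. \<Sum>a\<in>UNIV. \<Sum>b\<in>UNIV. \<Sum>c\<in>UNIV. \<Sum>\<nu>\<in>UNIV. \<Sum>l\<in>UNIV. (eps \<mu> \<nu> l * eps a b c) \<odot> ?BA \<mu> \<nu> l a b c)"
    by (intro sum.cong refl sum_swap_4)
  also have "\<dots> = (\<Sum>a\<in>UNIV. \<Sum>b\<in>UNIV. \<Sum>c\<in>UNIV. \<Sum>\<mu>\<in>UNIV. \<Sum>\<nu>\<in>UNIV. \<Sum>l\<in>UNIV. (eps \<mu> \<nu> l * eps a b c) \<odot> ?BA \<mu> \<nu> l a b c)"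
    by (rule sum_swap_4)
  finally have BA: "\<dots> = (\<Sum>\<mu>\<in>UNIV. \<Sum>\<nu>\<in>UNIV. \<Sum>l\<in>UNIV. \<Sum>a\<in>UNIV. \<Sum>b\<in>UNIV. \<Sum>c\<in>UNIV. (eps \<mu> \<nu> l * eps a b c) \<odot> ?BA \<mu> \<nu> l a b c)" ..
  let ?C = "\<lambda>\<mu> a b c. eps a b c \<odot> (dqf \<mu> (FCbar a) \<star> bg (Ah b \<mu>) \<star> qf (FC c))"
    and ?Xi = "\<lambda>\<mu> a b c. eps a b c \<odot> (dqf \<mu> (FXibar a) \<star> bg (Ah b \<mu>) \<star> qf (FXi c))"
  have "L_one_loop Ah = - ((\<Sum>a\<in>UNIV. \<Sum>b\<in>UNIV. \<Sum>c\<in>UNIV. \<Sum>\<mu>\<in>UNIV. \<Sum>\<nu>\<in>UNIV. \<Sum>l\<in>UNIV. (eps \<mu> \<nu> l * eps a b c) \<odot> ?BA \<mu> \<nu> l a b c)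
     + (\<Sum>a\<in>UNIV. \<Sum>b\<in>UNIV. \<Sum>c\<in>UNIV. \<Sum>\<mu>\<in>UNIV. ?C \<mu> a b c) + (\<Sum>a\<in>UNIV. \<Sum>b\<in>UNIV. \<Sum>c\<in>UNIV. \<Sum>\<mu>\<in>UNIV. ?Xi \<mu> a b c))"
    unfolding L_one_loop_def dscale_add dscale_sum sum.distrib dscale_dscale
    by (simp only: mult.commute)
  also have "\<dots> = - ((\<Sum>\<mu>\<in>UNIV. \<Sum>\<nu>\<in>UNIV. \<Sum>l\<in>UNIV. \<Sum>a\<in>UNIV. \<Sum>b\<in>UNIV. \<Sum>c\<in>UNIV. (eps \<mu> \<nu> l * eps a b c) \<odot> ?BA \<mu> \<nu> l a b c)
     + (\<Sum>\<mu>\<in>UNIV. \<Sum>a\<in>UNIV. \<Sum>b\<in>UNIV. \<Sum>c\<in>UNIV. ?C \<mu> a b c) + (\<Sum>\<mu>\<in>UNIV. \<Sum>a\<in>UNIV. \<Sum>b\<in>UNIV. \<Sum>c\<in>UNIV. ?Xi \<mu> a b c))"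
    by (intro arg_cong[of _ _ uminus] arg_cong2[of _ _ _ _ "(+)"] BA sum_swap_4[symmetric])
  finally have one_loop: "L_one_loop Ah = \<dots>" .
  have regroup: "T - (p + q + r) - (p' + q' + r') = T + - (p + p' + q') + (- (q + r) - r')"
    for T p q r p' q' r' :: density
    by (simp add: algebra_simps)
  show ?thesis
    unfolding one_loop unfolding L_tilde_def L_rest_def dscale_add sum.distrib by (rule regroup)
qed

section \<open>Partial derivatives and harmonic functions\<close>

lemma has_derivative_pd:
  fixes f :: "pt \<Rightarrow> real"
  assumes "(f has_derivative f') (at x)"
  shows "pd i f x = f' (axis i 1)"
proof -
  have "((\<lambda>s. f (x + s *\<^sub>R axis i 1)) has_vector_derivative f' (axis i 1)) (at 0)"
  proof -
    have "((\<lambda>s. x + s *\<^sub>R axis i 1) has_derivative (\<lambda>s. s *\<^sub>R axis i 1)) (at (0::real))"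
      by (auto intro!: derivative_eq_intros)
    moreover have "(f has_derivative f') (at (x + 0 *\<^sub>R axis i 1))"
      using assms by simp
    ultimately have "((\<lambda>s. f (x + s *\<^sub>R axis i 1)) has_derivative (\<lambda>s. f' (s *\<^sub>R axis i 1))) (at 0)"
      by (rule has_derivative_compose)
    then show ?thesis
      using linear_scale[OF has_derivative_linear[OF assms]] by (simp add: has_vector_derivative_def)
  qed
  then show ?thesis
    unfolding pd_def by (rule vector_derivative_at)
qed

lemma DERIV_pd:
  fixes f :: "pt \<Rightarrow> real"
  assumes "f differentiable at (x + s *\<^sub>R axis i 1)"
  shows "((\<lambda>s. f (x + s *\<^sub>R axis i 1)) has_real_derivative pd i f (x + s *\<^sub>R axis i 1)) (at s)"
proof -
  obtain f' where f': "(f has_derivative f') (at (x + s *\<^sub>R axis i 1))"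
    using assms by (auto simp: differentiable_def)
  have "((\<lambda>s. x + s *\<^sub>R axis i 1) has_derivative (\<lambda>s. s *\<^sub>R axis i 1)) (at s)"
    by (auto intro!: derivative_eq_intros)
  then have "((\<lambda>s. f (x + s *\<^sub>R axis i 1)) has_derivative (\<lambda>s. f' (s *\<^sub>R axis i 1))) (at s)"
    using f' by (rule has_derivative_compose)
  moreover have "(\<lambda>s. f' (s *\<^sub>R axis i 1)) = (*) (pd i f (x + s *\<^sub>R axis i 1))"
    using linear_scale[OF has_derivative_linear[OF f']] by (simp add: has_derivative_pd[OF f'] fun_eq_iff)
  ultimately show ?thesis
    by (simp add: has_field_derivative_def)
qed

lemma pd_diff:
  fixes f h :: "pt \<Rightarrow> real"
  assumes "f differentiable at x" "h differentiable at x"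
  shows "pd i (\<lambda>x. f x - h x) x = pd i f x - pd i h x"
proof -
  obtain f' h' where "(f has_derivative f') (at x)" "(h has_derivative h') (at x)"
    using assms by (auto simp: differentiable_def)
  then show ?thesis
    using has_derivative_pd has_derivative_diff[of f f' "at x" h h'] by metis
qed

lemma pd_const: "pd i (\<lambda>x. c) x = 0"
  by (simp add: pd_def)

lemma pd_uminus:
  fixes f :: "pt \<Rightarrow> real"
  assumes "f differentiable at x"
  shows "pd i (\<lambda>x. - f x) x = - pd i f x"
  using pd_diff[of "\<lambda>x. 0" x f i] assms by (simp add: pd_const)

lemma pd_sum:
  fixes f :: "'i \<Rightarrow> pt \<Rightarrow> real"
  assumes "\<And>k. k \<in> A \<Longrightarrow> f k differentiable at x"
  shows "pd i (\<lambda>x. \<Sum>k\<in>A. f k x) x = (\<Sum>k\<in>A. pd i (f k) x)"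
proof -
  obtain f' where f': "\<And>k. k \<in> A \<Longrightarrow> (f k has_derivative f' k) (at x)"
    using assms unfolding differentiable_def by metis
  then have "((\<lambda>x. \<Sum>k\<in>A. f k x) has_derivative (\<lambda>y. \<Sum>k\<in>A. f' k y)) (at x)"
    by (rule has_derivative_sum)
  from has_derivative_pd[OF this] show ?thesis
    using has_derivative_pd[OF f'] by simp
qed

text \<open>The mean value theorem in direction \<open>i\<close>, applied to the increment in
  direction \<open>j\<close>, leaves a difference of \<open>pd i f\<close> at two points near
  \<open>x\<close>; both values are then replaced by their linear approximation at
  \<open>x\<close>.\<close>

lemma second_difference:
  fixes f :: "pt \<Rightarrow> real"
  assumes f: "\<And>x. f differentiable at x" and u: "pd i f differentiable at x" and "0 < \<epsilon>"
  shows "\<exists>\<delta>>0. \<forall>t. 0 < t \<and> t < \<delta> \<longrightarrow>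
    \<bar>f (x + t *\<^sub>R axis i 1 + t *\<^sub>R axis j 1) - f (x + t *\<^sub>R axis i 1) - f (x + t *\<^sub>R axis j 1) + f x
      - t\<^sup>2 * pd j (pd i f) x\<bar> \<le> \<epsilon> * t\<^sup>2"
proof -
  let ?e = "\<lambda>i. axis i 1 :: pt"
  obtain u' where u': "(pd i f has_derivative u') (at x)"
    using u by (auto simp: differentiable_def)
  \<comment> \<open>The displacements used below have norms at most 2 * t and t, so errors of
    \<epsilon> / 3 per unit length add up to \<epsilon> * t, and t < d / 2 keeps both within
    reach.\<close>
  then obtain d where d: "d > 0"
    "\<And>y. norm (y - x) < d \<Longrightarrow> \<bar>pd i f y - pd i f x - u' (y - x)\<bar> \<le> \<epsilon> / 3 * norm (y - x)"
    using \<open>0 < \<epsilon>\<close> unfolding has_derivative_at_alt real_norm_def by (metis divide_pos_pos zero_less_numeral)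
  have lin: "linear u'"
    using u' by (rule has_derivative_linear)
  show ?thesis
  proof (intro exI[of _ "d / 2"] conjI allI impI)
    show "0 < d / 2"
      using d by simp
    fix t assume t: "0 < t \<and> t < d / 2"
    define \<phi> where "\<phi> s = f ((x + t *\<^sub>R ?e j) + s *\<^sub>R ?e i) - f (x + s *\<^sub>R ?e i)" for s
    define \<phi>' where "\<phi>' s = pd i f ((x + t *\<^sub>R ?e j) + s *\<^sub>R ?e i) - pd i f (x + s *\<^sub>R ?e i)" for s
    have "(\<phi> has_real_derivative \<phi>' s) (at s)" for s
      unfolding \<phi>_def \<phi>'_def by (intro DERIV_diff DERIV_pd f)
    then obtain s where s: "0 < s" "s < t" "\<phi> t - \<phi> 0 = (t - 0) * \<phi>' s"
      using MVT2[of 0 t \<phi> \<phi>'] t by blast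
    let ?y = "t *\<^sub>R ?e j + s *\<^sub>R ?e i" and ?z = "s *\<^sub>R ?e i"
    have norms: "norm ?y \<le> 2 * t" "norm ?z \<le> t"
      using norm_triangle_ineq[of "t *\<^sub>R ?e j" "s *\<^sub>R ?e i"] s t by simp_all
    have "\<bar>pd i f (x + ?y) - pd i f x - u' ?y\<bar> \<le> \<epsilon> / 3 * norm ?y"
      "\<bar>pd i f (x + ?z) - pd i f x - u' ?z\<bar> \<le> \<epsilon> / 3 * norm ?z"
      using d(2)[of "x + ?y"] d(2)[of "x + ?z"] norms t by simp_all
    moreover have "\<epsilon> / 3 * norm ?y \<le> 2 / 3 * (\<epsilon> * t)" "\<epsilon> / 3 * norm ?z \<le> 1 / 3 * (\<epsilon> * t)"
      using mult_left_mono[OF norms(1), of "\<epsilon> / 3"] mult_left_mono[OF norms(2), of "\<epsilon> / 3"] \<open>0 < \<epsilon>\<close>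
      by (simp_all del: norm_scaleR)
    moreover have "u' ?y - u' ?z = t * pd j (pd i f) x"
      using lin by (simp add: linear_add linear_scale has_derivative_pd[OF u'])
    moreover have "\<phi>' s = pd i f (x + ?y) - pd i f (x + ?z)"
      by (simp add: \<phi>'_def add.assoc)
    ultimately have "\<bar>\<phi>' s - t * pd j (pd i f) x\<bar> \<le> \<epsilon> * t"
      by linarith
    then have "t * \<bar>\<phi>' s - t * pd j (pd i f) x\<bar> \<le> t * (\<epsilon> * t)"
      using t by (intro mult_left_mono) auto
    then have "\<bar>t * (\<phi>' s - t * pd j (pd i f) x)\<bar> \<le> \<epsilon> * t\<^sup>2"
      using t by (simp add: abs_mult power2_eq_square mult_ac)
    moreover have "f (x + t *\<^sub>R ?e i + t *\<^sub>R ?e j) - f (x + t *\<^sub>R ?e i) - f (x + t *\<^sub>R ?e j) + f x = \<phi> t - \<phi> 0"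
      by (simp add: \<phi>_def algebra_simps)
    ultimately show "\<bar>f (x + t *\<^sub>R ?e i + t *\<^sub>R ?e j) - f (x + t *\<^sub>R ?e i) - f (x + t *\<^sub>R ?e j) + f x
        - t\<^sup>2 * pd j (pd i f) x\<bar> \<le> \<epsilon> * t\<^sup>2"
      using s(3) by (simp add: algebra_simps power2_eq_square)
  qed
qed

text \<open>The second difference is symmetric in \<open>i\<close> and \<open>j\<close>, and both
  mixed derivatives times t^2 approximate it. Differentiable first partial derivatives suffice for
  this, which is the regularity that \<open>perturbative_field\<close> grants.\<close>

lemma pd_commute:
  fixes f :: "pt \<Rightarrow> real"
  assumes f: "\<And>x. f differentiable at x" and "pd i f differentiable at x" "pd j f differentiable at x"
  shows "pd i (pd j f) x = pd j (pd i f) x"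
proof -
  have "\<bar>pd i (pd j f) x - pd j (pd i f) x\<bar> \<le> \<epsilon>" if pos: "0 < \<epsilon>" for \<epsilon>
  proof -
    let ?D = "\<lambda>i j t. f (x + t *\<^sub>R axis i 1 + t *\<^sub>R axis j 1) - f (x + t *\<^sub>R axis i 1) - f (x + t *\<^sub>R axis j 1) + f x"
    obtain d where d: "d > 0" "\<And>t. 0 < t \<Longrightarrow> t < d \<Longrightarrow> \<bar>?D i j t - t\<^sup>2 * pd j (pd i f) x\<bar> \<le> \<epsilon> / 2 * t\<^sup>2"
      using second_difference[OF f assms(2) half_gt_zero[OF pos], of j] by blast
    obtain d' where d': "d' > 0" "\<And>t. 0 < t \<Longrightarrow> t < d' \<Longrightarrow> \<bar>?D j i t - t\<^sup>2 * pd i (pd j f) x\<bar> \<le> \<epsilon> / 2 * t\<^sup>2"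
      using second_difference[OF f assms(3) half_gt_zero[OF pos], of i] by blast
    define t where "t = min d d' / 2"
    have t: "0 < t" "t < d" "t < d'"
      using d(1) d'(1) by (auto simp: t_def)
    have "?D j i t = ?D i j t"
      by (simp add: add_ac)
    then have "\<bar>t\<^sup>2 * pd i (pd j f) x - t\<^sup>2 * pd j (pd i f) x\<bar> \<le> \<epsilon> * t\<^sup>2"
      using d(2)[OF t(1,2)] d'(2)[OF t(1,3)] by linarith
    then have "t\<^sup>2 * \<bar>pd i (pd j f) x - pd j (pd i f) x\<bar> \<le> t\<^sup>2 * \<epsilon>"
      by (simp add: abs_mult mult.commute flip: right_diff_distrib)
    then show ?thesis
      using t(1) by simp
  qed
  then show ?thesis
    by (metis abs_le_zero_iff eq_iff_diff_eq_0 field_le_epsilon add_0)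
qed

section \<open>The maximum principle for harmonic functions\<close>

lemma second_derivative_local_max:
  fixes \<psi> :: "real \<Rightarrow> real"
  assumes "\<And>s. (\<psi> has_real_derivative \<psi>' s) (at s)" "(\<psi>' has_real_derivative l) (at 0)"
    and "0 < d" "\<And>s. \<bar>s\<bar> < d \<Longrightarrow> \<psi> s \<le> \<psi> 0"
  shows "l \<le> 0"
proof (rule ccontr)
  assume "\<not> l \<le> 0"
  have "\<psi>' 0 = 0"
    using DERIV_local_max[OF assms(1)[of 0] assms(3)] assms(4) by simp
  obtain d' where d': "d' > 0" "\<And>h. 0 < h \<Longrightarrow> h < d' \<Longrightarrow> \<psi>' 0 < \<psi>' (0 + h)"
    using DERIV_pos_inc_right[OF assms(2)] \<open>\<not> l \<le> 0\<close> by auto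
  define t where "t = min d d' / 2"
  have t: "0 < t" "t < d" "t < d'"
    using assms(3) d'(1) by (auto simp: t_def)
  obtain s where "0 < s" "s < t" "\<psi> t - \<psi> 0 = (t - 0) * \<psi>' s"
    using MVT2[OF t(1), of \<psi> \<psi>'] assms(1) by blast
  moreover have "\<psi>' s > 0"
    using d'(2)[of s] calculation t \<open>\<psi>' 0 = 0\<close> by simp
  ultimately have "0 < \<psi> t - \<psi> 0"
    using t(1) by simp
  then show False
    using assms(4)[of t] t by simp
qed

lemma harmonic_nonpos:
  fixes f :: "pt \<Rightarrow> real"
  assumes f: "\<And>x. f differentiable at x" "\<And>i x. pd i f differentiable at x"
    and laplace: "\<And>x. (\<Sum>i\<in>UNIV. pd i (pd i f) x) = 0"
    and lim: "(f \<longlongrightarrow> 0) at_infinity"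
  shows "f x0 \<le> 0"
proof (rule ccontr)
  assume "\<not> f x0 \<le> 0"
  define m where "m = f x0"
  have m: "0 < m"
    using \<open>\<not> f x0 \<le> 0\<close> by (simp add: m_def)
  have "eventually (\<lambda>y. f y < m / 2) at_infinity"
    using lim m by (intro order_tendstoD(2)) auto
  then obtain b where b: "\<And>y. b \<le> norm y \<Longrightarrow> f y < m / 2"
    by (auto simp: eventually_at_infinity)
  define R where "R = max b (norm x0 + 1)"
  have R: "norm x0 < R" "0 < R" "\<And>y. norm y = R \<Longrightarrow> f y < m / 2"
    using b norm_ge_zero[of x0] by (auto simp: R_def less_max_iff_disj simp del: norm_ge_zero)
  \<comment> \<open>On the sphere of radius \<open>R\<close>, \<open>h\<close> stays below m / 2 + m
    / 4, while it is at least \<open>m\<close> at \<open>x0\<close>, which lies strictly inside; so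
    the maximum of \<open>h\<close> is interior.\<close>
  define c where "c = m / (4 * R\<^sup>2)"
  have c: "0 < c" "c * R\<^sup>2 = m / 4"
    using m R(2) by (auto simp: c_def field_simps)
  \<comment> \<open>a maximum of \<open>h\<close> in the interior would contradict that its Laplacian is \<open>6 * c > 0\<close>\<close>
  define h where "h y = f y + c * (norm y)\<^sup>2" for y
  have "continuous_on (cball 0 R) h"
    unfolding h_def using f(1)
    by (intro continuous_intros continuous_at_imp_continuous_on ballI differentiable_imp_continuous_within)
  then obtain z where z: "z \<in> cball 0 R" "\<And>y. y \<in> cball 0 R \<Longrightarrow> h y \<le> h z"
    using continuous_attains_sup[of "cball (0::pt) R" h] R(2) by auto
  have "m \<le> h x0"
    using c(1) by (simp add: h_def m_def)
  also have "\<dots> \<le> h z"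
    using z(2)[of x0] R(1) by simp
  finally have "norm z \<noteq> R"
    using R(3)[of z] c(2) m by (auto simp: h_def)
  then have zR: "norm z < R"
    using z(1) by simp
  have "pd i (pd i f) z + 2 * c \<le> 0" for i
  proof (rule second_derivative_local_max)
    \<comment> \<open>This is \<open>h\<close> along the axis through \<open>z\<close>, with the
      squared norm expanded into a polynomial in \<open>s\<close>.\<close>
    let ?\<psi> = "\<lambda>s. f (z + s *\<^sub>R axis i 1) + c * ((norm z)\<^sup>2 + 2 * s * z $ i + s\<^sup>2)"
    show "(?\<psi> has_real_derivative pd i f (z + s *\<^sub>R axis i 1) + c * (2 * z $ i + 2 * s)) (at s)" for s
      by (rule DERIV_add[OF DERIV_pd[OF f(1)]]) (auto intro!: derivative_eq_intros)
    have "((\<lambda>s. pd i f (z + s *\<^sub>R axis i 1)) has_real_derivative pd i (pd i f) z) (at 0)"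
      using DERIV_pd[of "pd i f" z 0 i, OF f(2)] by simp
    then show "((\<lambda>s. pd i f (z + s *\<^sub>R axis i 1) + c * (2 * z $ i + 2 * s)) has_real_derivative
        pd i (pd i f) z + 2 * c) (at 0)"
      by (rule DERIV_add) (auto intro!: derivative_eq_intros)
    show "0 < R - norm z"
      using zR by simp
    fix s :: real assume s: "\<bar>s\<bar> < R - norm z"
    have "norm (z + s *\<^sub>R axis i 1) \<le> R"
      using norm_triangle_ineq[of z "s *\<^sub>R axis i 1"] s by simp
    then have "h (z + s *\<^sub>R axis i 1) \<le> h z"
      using z(2) by simp
    moreover have "(norm (z + s *\<^sub>R axis i 1))\<^sup>2 = (norm z)\<^sup>2 + 2 * s * z $ i + s\<^sup>2"
      unfolding power2_norm_eq_inner
      by (simp add: inner_add inner_axis inner_axis' power2_eq_square algebra_simps)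
    ultimately show "?\<psi> s \<le> ?\<psi> 0"
      by (simp add: h_def)
  qed
  then have "(\<Sum>i\<in>UNIV. pd i (pd i f) z + 2 * c) \<le> (\<Sum>i\<in>(UNIV :: 3 set). 0)"
    by (intro sum_mono)
  then show False
    using laplace[of z] c(1) by (simp add: sum.distrib)
qed

lemma harmonic_zero:
  fixes f :: "pt \<Rightarrow> real"
  assumes f: "\<And>x. f differentiable at x" "\<And>i x. pd i f differentiable at x"
    and laplace: "\<And>x. (\<Sum>i\<in>UNIV. pd i (pd i f) x) = 0"
    and lim: "(f \<longlongrightarrow> 0) at_infinity"
  shows "f x = 0"
proof -
  have pd: "pd i (\<lambda>x. - f x) = (\<lambda>x. - pd i f x)" for i
    using pd_uminus[OF f(1)] by blast
  have "- f x \<le> 0"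
  proof (rule harmonic_nonpos)
    show "(\<Sum>i\<in>UNIV. pd i (pd i (\<lambda>x. - f x)) x) = 0" for x
      unfolding pd by (simp add: pd_uminus[OF f(2)] sum_negf laplace)
    show "((\<lambda>x. - f x) \<longlongrightarrow> 0) at_infinity"
      using tendsto_minus[OF lim] by simp
  qed (use f pd in auto)
  then show ?thesis
    using harmonic_nonpos[OF f laplace lim, of x] by simp
qed

lemma curl_symmetric:
  assumes "\<And>\<mu>. (\<Sum>\<nu>\<in>UNIV. \<Sum>l\<in>UNIV. eps \<mu> \<nu> l / 2 * (d \<nu> l - d l \<nu>)) = 0"
  shows "d \<nu> l = d l \<nu>"
proof -
  have "\<forall>\<nu> l. d \<nu> l = d l \<nu>"
    using assms[of 1] assms[of 2] assms[of 3] by (simp add: forall_3 sum_3 eps_def)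
  then show ?thesis
    by blast
qed

text \<open>Absence of curl allows the exchange of indices in the first derivatives, so that the
  Laplacian of \<open>a l\<close> becomes the derivative in direction \<open>l\<close> of the
  divergence.\<close>

lemma vector_field_zero:
  fixes a :: "3 \<Rightarrow> pt \<Rightarrow> real"
  assumes a: "\<And>l x. a l differentiable at x" "\<And>l i x. pd i (a l) differentiable at x"
    and curl: "\<And>\<mu> x. (\<Sum>\<nu>\<in>UNIV. \<Sum>l\<in>UNIV. eps \<mu> \<nu> l / 2 * (pd \<nu> (a l) x - pd l (a \<nu>) x)) = 0"
    and divergence: "\<And>x. (\<Sum>\<mu>\<in>UNIV. pd \<mu> (a \<mu>) x) = 0"
    and lim: "\<And>l. (a l \<longlongrightarrow> 0) at_infinity"
  shows "a l x = 0"
proof (rule harmonic_zero[OF a(1) a(2) _ lim])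
  have sym: "pd \<nu> (a l) = pd l (a \<nu>)" for \<nu> l
    using curl_symmetric[of "\<lambda>\<nu> l. pd \<nu> (a l) x" \<nu> l for x] curl by blast
  show "(\<Sum>i\<in>UNIV. pd i (pd i (a l)) x) = 0" for x
  proof -
    have "(\<Sum>i\<in>UNIV. pd i (pd i (a l)) x) = (\<Sum>i\<in>UNIV. pd l (pd i (a i)) x)"
      using sym[of _ l] pd_commute[OF a(1) a(2) a(2)] by simp
    also have "\<dots> = pd l (\<lambda>x. \<Sum>i\<in>UNIV. pd i (a i) x) x"
      by (intro pd_sum[symmetric] a(2))
    also have "\<dots> = 0"
      unfolding divergence by (rule pd_const)
    finally show ?thesis .
  qed
qed

section \<open>The classical field depends only on the source of B\<close>

definition word_derivative :: "jet list \<Rightarrow> (jet \<Rightarrow> pt \<Rightarrow> real fps) \<Rightarrow> jet \<Rightarrow> pt \<Rightarrow> real fps" where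
  "word_derivative w u j x = (\<Sum>i | i < length w \<and> w ! i = j. \<Prod>k\<in>{..<length w} - {i}. u (w ! k) x)"

text \<open>Putting 1 at the removed position gives sums and products over full initial segments,
  which unfold for explicit words.\<close>

lemma word_derivative_altdef:
  "word_derivative w u j x =
    (\<Sum>i<length w. if w ! i = j then \<Prod>k<length w. if k = i then 1 else u (w ! k) x else 0)"
proof -
  have "(\<Prod>k\<in>{..<length w} - {i}. u (w ! k) x) = (\<Prod>k<length w. if k = i then 1 else u (w ! k) x)" for i
    by (intro prod.mono_neutral_cong_left) auto
  then have "word_derivative w u j x = (\<Sum>i | i \<in> {..<length w} \<and> w ! i = j.
      \<Prod>k<length w. if k = i then 1 else u (w ! k) x)"
    by (simp add: word_derivative_def)
  also have "\<dots> = (\<Sum>i<length w. if w ! i = j then \<Prod>k<length w. if k = i then 1 else u (w ! k) x else 0)"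
    by (rule sum.inter_filter) simp
  finally show ?thesis .
qed

lemma word_derivative_2:
  "word_derivative [p, q] u j x = (if p = j then u q x else 0) + (if q = j then u p x else 0)"
  unfolding word_derivative_altdef by (simp add: lessThan_Suc)

lemma word_derivative_3:
  "word_derivative [p, q, r] u j x = (if p = j then u q x * u r x else 0) +
     (if q = j then u p x * u r x else 0) + (if r = j then u p x * u q x else 0)"
  unfolding word_derivative_altdef by (simp add: lessThan_Suc algebra_simps)

text \<open>The range of summation depends on \<open>p\<close>; linearity becomes visible only over
  a common finite set of words.\<close>

lemma jet_derivative_superset:
  assumes "finite W" "{w. p w \<noteq> 0} \<subseteq> W"
  shows "jet_derivative p u j x = (\<Sum>w\<in>W. p w x * word_derivative w u j x)"
  unfolding jet_derivative_def word_derivative_def[symmetric]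
  using assms by (intro sum.mono_neutral_left) auto

lemma jet_derivative_monomial: "jet_derivative (monomial f w) u j x = f x * word_derivative w u j x"
  by (subst jet_derivative_superset[of "{w}"]) (auto simp: monomial_def fun_eq_iff)

lemma jet_derivative_add:
  assumes "finite_support p" "finite_support q"
  shows "jet_derivative (p + q) u j x = jet_derivative p u j x + jet_derivative q u j x"
proof -
  let ?W = "{w. p w \<noteq> 0} \<union> {w. q w \<noteq> 0}"
  have "finite ?W"
    using assms by (simp add: finite_support_def)
  then have "jet_derivative (p + q) u j x = (\<Sum>w\<in>?W. (p + q) w x * word_derivative w u j x)"
    "jet_derivative p u j x = (\<Sum>w\<in>?W. p w x * word_derivative w u j x)"
    "jet_derivative q u j x = (\<Sum>w\<in>?W. q w x * word_derivative w u j x)"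
    by (intro jet_derivative_superset; auto)+
  then show ?thesis
    by (simp add: distrib_right sum.distrib)
qed

lemma jet_derivative_diff:
  assumes "finite_support p" "finite_support q"
  shows "jet_derivative (p - q) u j x = jet_derivative p u j x - jet_derivative q u j x"
  using jet_derivative_add[OF finite_support_diff[OF assms] assms(2), of u j x] by simp

lemma jet_derivative_sum:
  assumes "\<And>i. i \<in> A \<Longrightarrow> finite_support (p i)"
  shows "jet_derivative (\<Sum>i\<in>A. p i) u j x = (\<Sum>i\<in>A. jet_derivative (p i) u j x)"
  using assms
proof (induction A rule: infinite_finite_induct)
  case (insert i A)
  have "jet_derivative (p i + (\<Sum>i\<in>A. p i)) u j x = jet_derivative (p i) u j x + jet_derivative (\<Sum>i\<in>A. p i) u j x"
    using insert(4) by (intro jet_derivative_add finite_support_sum) auto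
  moreover have "jet_derivative (\<Sum>i\<in>A. p i) u j x = (\<Sum>i\<in>A. jet_derivative (p i) u j x)"
    using insert(3,4) by blast
  ultimately show ?case
    unfolding sum.insert[OF insert(1,2)] by presburger
qed (simp_all add: jet_derivative_def)

lemma fpd_zero: "fpd \<mu> (\<lambda>x. 0) x = 0"
  by (rule fps_ext) (simp add: fpd_def pd_const)

text \<open>\<open>B\<close> enters \<open>L_S\<close> linearly and without derivatives, so its
  variation is the dual of the curvature of \<open>Ah\<close>, in which neither \<open>Bh\<close>
  nor \<open>g\<close> is left.\<close>

lemma field_equation_B:
  "functional_derivative (L_S g) (classical_config Ah Bh) (FB a \<mu>) x =
    (\<Sum>\<nu>\<in>UNIV. \<Sum>l\<in>UNIV. fps_const (eps \<mu> \<nu> l / 2) * (fpd \<nu> (Ah a l) x - fpd l (Ah a \<nu>) x -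
       (\<Sum>b\<in>UNIV. \<Sum>c\<in>UNIV. fps_const (eps a b c) * (Ah b \<nu> x * Ah c l x))))"
proof -
  have L_S: "L_S g = (\<Sum>\<mu>\<in>UNIV. \<Sum>\<nu>\<in>UNIV. \<Sum>l\<in>UNIV.
      (\<Sum>a\<in>UNIV. monomial (\<lambda>x. fps_const (eps \<mu> \<nu> l / 2)) [Jet [] (FB a \<mu>), Jet [\<nu>] (FA a l)]
        - monomial (\<lambda>x. fps_const (eps \<mu> \<nu> l / 2)) [Jet [] (FB a \<mu>), Jet [l] (FA a \<nu>)]
        - (\<Sum>b\<in>UNIV. \<Sum>c\<in>UNIV. monomial (\<lambda>x. fps_const (eps \<mu> \<nu> l / 2 * eps a b c))
             [Jet [] (FB a \<mu>), Jet [] (FA b \<nu>), Jet [] (FA c l)]))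
      + ((\<Sum>a\<in>UNIV. monomial (\<lambda>x. fps_const (eps \<mu> \<nu> l * g / 2)) [Jet [] (FA a \<mu>), Jet [\<nu>] (FA a l)])
        - (\<Sum>a\<in>UNIV. \<Sum>b\<in>UNIV. \<Sum>c\<in>UNIV. monomial (\<lambda>x. fps_const (eps \<mu> \<nu> l * g * (eps a b c / 6)))
             [Jet [] (FA a \<mu>), Jet [] (FA b \<nu>), Jet [] (FA c l)])))"
    unfolding L_S_def curvature_def
    by (simp only: density_linear density_monomial append.simps)
      (simp add: mult_ac)
  let ?u = "classical_config Ah Bh"
  \<comment> \<open>No derivative of \<open>B\<close> occurs, hence the divergence term of the
    functional derivative vanishes.\<close>
  have other: "jet_derivative (L_S g) ?u (Jet [i] (FB a \<mu>)) = (\<lambda>x. 0)" for i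
    unfolding L_S
    by (intro ext) (simp add: jet_derivative_sum jet_derivative_add jet_derivative_diff jet_derivative_monomial
      finite_support_intros word_derivative_2 word_derivative_3)
  let ?T = "\<lambda>\<nu> l. fps_const (eps \<mu> \<nu> l / 2) * (fpd \<nu> (Ah a l) x - fpd l (Ah a \<nu>) x -
       (\<Sum>b\<in>UNIV. \<Sum>c\<in>UNIV. fps_const (eps a b c) * (Ah b \<nu> x * Ah c l x)))"
  have "jet_derivative (L_S g) ?u (Jet [] (FB a \<mu>)) x =
      (\<Sum>\<mu>'\<in>UNIV. \<Sum>\<nu>\<in>UNIV. \<Sum>l\<in>UNIV. \<Sum>a'\<in>UNIV. if a' = a then if \<mu>' = \<mu> then ?T \<nu> l else 0 else 0)"
    unfolding L_S
    by (simp add: jet_derivative_sum jet_derivative_add jet_derivative_diff jet_derivative_monomial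
      finite_support_intros word_derivative_2 word_derivative_3 del: sum.delta sum.delta', intro sum.cong refl)
      (auto simp: right_diff_distrib sum_distrib_left mult.assoc[symmetric])
  also have "\<dots> = (\<Sum>\<mu>'\<in>UNIV. if \<mu>' = \<mu> then \<Sum>\<nu>\<in>UNIV. \<Sum>l\<in>UNIV. ?T \<nu> l else 0)"
    by (intro sum.cong refl) simp
  also have "\<dots> = (\<Sum>\<nu>\<in>UNIV. \<Sum>l\<in>UNIV. ?T \<nu> l)"
    by simp
  finally show ?thesis
    by (simp add: functional_derivative_def other fpd_zero)
qed

lemma perturbative_fieldD:
  assumes "perturbative_field F"
  shows "fps_nth (F x) 0 = 0" "(\<lambda>x. fps_nth (F x) k) differentiable at x"
    "pd i (\<lambda>x. fps_nth (F x) k) differentiable at x"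
    "((\<lambda>x. fps_nth (F x) k) \<longlongrightarrow> 0) at_infinity"
proof -
  have "foldr pd \<alpha> (\<lambda>x. fps_nth (F x) k) differentiable_on UNIV" if "length \<alpha> \<le> 1" for \<alpha>
    using assms that unfolding perturbative_field_def by blast
  from this[of "[]"] this[of "[i]"]
  show "(\<lambda>x. fps_nth (F x) k) differentiable at x" "pd i (\<lambda>x. fps_nth (F x) k) differentiable at x"
    by (simp_all add: differentiable_on_def)
qed (use assms in \<open>auto simp: perturbative_field_def\<close>)

text \<open>At order \<open>k\<close> the quadratic term of the field equation involves only lower orders, so that
  the difference of two solutions is free of curl and divergence.\<close>

lemma classical_A_unique:
  assumes "classical_fields g J K A B" "classical_fields g J' K A' B'"
  shows "A = A'"
proof -
  have pert: "perturbative_field (A a \<mu>)" "perturbative_field (A' a \<mu>)" for a \<mu>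
    using assms by (simp_all add: classical_fields_def)
  have "\<forall>a \<mu> x. fps_nth (A a \<mu> x) k = fps_nth (A' a \<mu> x) k" for k
  proof (induction k rule: less_induct)
    case (less k)
    define d where "d a \<mu> x = fps_nth (A a \<mu> x) k - fps_nth (A' a \<mu> x) k" for a \<mu> x
    have pd_d: "pd i (d a \<mu>) = (\<lambda>x. pd i (\<lambda>x. fps_nth (A a \<mu> x) k) x - pd i (\<lambda>x. fps_nth (A' a \<mu> x) k) x)"
      for i a \<mu>
      unfolding d_def by (intro ext pd_diff perturbative_fieldD(2) pert)
    have quadratic: "fps_nth (A b \<nu> x * A c l x) k = fps_nth (A' b \<nu> x * A' c l x) k" for b \<nu> c l x
      unfolding fps_mult_nth
    proof (intro sum.cong refl)
      fix i assume "i \<in> {0..k}"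
      \<comment> \<open>The end terms of the Cauchy product contain order \<open>k\<close>, but
        multiplied by order 0, which vanishes; elsewhere both orders are below
        \<open>k\<close>.\<close>
      then consider "i = 0" | "k - i = 0" | "i < k" "k - i < k"
        by fastforce
      then show "fps_nth (A b \<nu> x) i * fps_nth (A c l x) (k - i) =
          fps_nth (A' b \<nu> x) i * fps_nth (A' c l x) (k - i)"
        by cases (use less perturbative_fieldD(1)[OF pert(1)] perturbative_fieldD(1)[OF pert(2)] in simp_all)
    qed
    have "d a \<mu> x = 0" for a \<mu> x
    proof (rule vector_field_zero)
      show "d a l differentiable at x" for l x
        unfolding d_def by (intro differentiable_diff perturbative_fieldD(2) pert)
      show "pd i (d a l) differentiable at x" for i l x
        unfolding pd_d by (intro differentiable_diff perturbative_fieldD(3) pert)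
      show "(d a l \<longlongrightarrow> 0) at_infinity" for l
        using tendsto_diff[OF perturbative_fieldD(4)[OF pert(1)] perturbative_fieldD(4)[OF pert(2)]]
        unfolding d_def by simp
      show "(\<Sum>\<mu>\<in>UNIV. pd \<mu> (d a \<mu>) x) = 0" for x
      proof -
        have "(\<Sum>\<mu>\<in>UNIV. fpd \<mu> (A a \<mu>) x) = 0" "(\<Sum>\<mu>\<in>UNIV. fpd \<mu> (A' a \<mu>) x) = 0"
          using assms by (simp_all add: classical_fields_def)
        from arg_cong[OF this(1), of "\<lambda>F. fps_nth F k"] arg_cong[OF this(2), of "\<lambda>F. fps_nth F k"]
        show ?thesis
          by (simp add: pd_d sum_subtractf fps_sum_nth fpd_def)
      qed
      fix \<mu> x
      \<comment> \<open>Both sides equal \<open>- K a \<mu> x\<close>, whatever \<open>J\<close> and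
        \<open>J'\<close> are.\<close>
      have "functional_derivative (L_S g) (classical_config A B) (FB a \<mu>) x =
          functional_derivative (L_S g) (classical_config A' B') (FB a \<mu>) x"
        using assms unfolding classical_fields_def by (metis add_right_cancel)
      from arg_cong[OF this, of "\<lambda>F. fps_nth F k"]
      have "(\<Sum>\<nu>\<in>UNIV. \<Sum>l\<in>UNIV. eps \<mu> \<nu> l / 2 * (pd \<nu> (\<lambda>x. fps_nth (A a l x) k) x - pd l (\<lambda>x. fps_nth (A a \<nu> x) k) x
            - (\<Sum>b\<in>UNIV. \<Sum>c\<in>UNIV. eps a b c * fps_nth (A b \<nu> x * A c l x) k))) =
          (\<Sum>\<nu>\<in>UNIV. \<Sum>l\<in>UNIV. eps \<mu> \<nu> l / 2 * (pd \<nu> (\<lambda>x. fps_nth (A' a l x) k) x - pd l (\<lambda>x. fps_nth (A' a \<nu> x) k) x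
            - (\<Sum>b\<in>UNIV. \<Sum>c\<in>UNIV. eps a b c * fps_nth (A b \<nu> x * A c l x) k)))"
        unfolding field_equation_B by (simp add: fps_sum_nth fpd_def quadratic)
      then show "(\<Sum>\<nu>\<in>UNIV. \<Sum>l\<in>UNIV. eps \<mu> \<nu> l / 2 * (pd \<nu> (d a l) x - pd l (d a \<nu>) x)) = 0"
        by (simp add: pd_d right_diff_distrib sum_subtractf)
    qed
    then show ?case
      by (simp add: d_def)
  qed
  then show ?thesis
    by (intro ext fps_ext) blast
qed


section \<open>The vacuum diagrams\<close>

text \<open>With two legs at each vertex there are as many lines as vertices.\<close>

lemma one_loop_number:
  assumes "D \<in> diagrams (L_one_loop Ah) n"
  shows "loop_number D = 1"
proof -
  have len: "length (fst D ! v) = 2" if "v < length (fst D)" for v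
    using assms supportedD[OF one_loop_vertices] that by (simp add: diagrams_iff) blast
  have complete: "complete_contraction (fst D) (snd D)"
    using assms by (simp add: diagrams_iff)
  have "(\<Sum>l\<in>legs (fst D). 1) = 2 * length (fst D)"
    unfolding sum_legs by (simp add: len)
  then have "card (snd D) = length (fst D)"
    using complete_contraction_sum[OF complete, of "\<lambda>_. 1 :: nat"] by simp
  then show ?thesis
    by (simp add: loop_number_def)
qed

lemma supported_add_neutral:
  assumes "supported p (\<lambda>w. 0 < word_charge w)" "supported q (\<lambda>w. word_charge w = 0)"
  shows "supported (p + q) (\<lambda>w. 0 \<le> word_charge w)" "supported q (\<lambda>w. 0 \<le> word_charge w)"
    and "word_charge w = 0 \<Longrightarrow> (p + q) w = q w"
proof -
  show "supported q (\<lambda>w. 0 \<le> word_charge w)"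
    using assms(2) by (rule supported_weaken) simp
  then show "supported (p + q) (\<lambda>w. 0 \<le> word_charge w)"
    using assms(1) by (intro supported_add) (auto elim: supported_weaken)
  show "(p + q) w = q w" if "word_charge w = 0"
    using supported_eq_0[OF assms(1), of w] that by (simp add: fun_eq_iff)
qed

lemma diagrams_add_neutral:
  assumes "supported p (\<lambda>w. 0 < word_charge w)" "supported q (\<lambda>w. word_charge w = 0)"
  shows "diagrams (p + q) = diagrams q"
proof
  show "diagrams (p + q) n = diagrams q n" for n
    using supported_add_neutral[OF assms] by (rule diagrams_neutral_eq)
qed

lemma diagram_sum_add_neutral:
  assumes "supported p (\<lambda>w. 0 < word_charge w)" "supported q (\<lambda>w. word_charge w = 0)"
    and "\<And>n. DD n \<subseteq> diagrams q n"
  shows "diagram_sum I g (p + q) DD = diagram_sum I g q DD"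
  using supported_add_neutral[OF assms(1,2)] assms(3)[folded diagrams_add_neutral[OF assms(1,2)]]
  by (rule diagram_sum_neutral_eq)

context formal_integration
begin

lemma path_integral_add_neutral:
  assumes "L - L_free g = p + q" "supported p (\<lambda>w. 0 < word_charge w)" "supported q (\<lambda>w. word_charge w = 0)"
  shows "path_integral I g L = diagram_sum I g q (diagrams q)"
  unfolding path_integral_def assms(1) diagrams_add_neutral[OF assms(2,3)]
  using assms(2,3) by (rule diagram_sum_add_neutral) simp

text \<open>Without vertices only the empty diagram remains.\<close>

lemma diagram_sum_zero_density: "diagram_sum I g 0 (diagrams 0) = 1"
proof (rule fps_ext)
  fix n
  show "fps_nth (diagram_sum I g 0 (diagrams 0)) n = fps_nth 1 n"
  proof (cases "n = 0")
    case True
    then show ?thesis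
      by (simp add: diagram_sum_0)
  next
    case False
    then have "diagrams 0 n = {}"
      by (auto simp: diagrams_def)
    then show ?thesis
      using False by (subst diagram_sum_nth) auto
  qed
qed

end

text \<open>Dependence on \<open>K\<close> alone is expressed by the order of the quantifiers:
  \<open>DD1\<close> and \<open>W1\<close> are fixed before \<open>J\<close>, \<open>Ah\<close> and
  \<open>Bh\<close>, so that \<open>K\<close> has to determine \<open>Ah\<close>.\<close>

theorem proposition3:
  fixes g :: real
    and I :: "nat \<Rightarrow> ((nat \<Rightarrow> pt) \<Rightarrow> complex) \<Rightarrow> complex"
  assumes "formal_integral I"
  shows "\<exists>(DD1 :: classical \<Rightarrow> nat \<Rightarrow> diagram set) (W1 :: classical \<Rightarrow> pert_series).
    \<forall>J K Ah Bh. classical_fields g J K Ah Bh \<longrightarrow>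
      (\<forall>n. vacuum_connected_diagrams g Ah Bh n = DD1 K n) \<and>
      (\<forall>n. DD1 K n = connected_diagrams (L_one_loop Ah) n) \<and>
      (\<forall>n. \<forall>D\<in>DD1 K n. loop_number D = 1) \<and>
      diagram_sum I g (L_tilde g Ah Bh - L_free g) (vacuum_connected_diagrams g Ah Bh)
        = pert_ln (vacuum_ratio I g Ah Bh) \<and>
      pert_ln (vacuum_ratio I g Ah Bh) = fps_const (fps_const \<i>) * W1 K \<and>
      fps_const (fps_const \<i>) * W1 K = diagram_sum I g (L_one_loop Ah) (DD1 K) \<and>
      pert_exp (fps_const (fps_const \<i>) * W1 K) = expectation_exp I g (L_one_loop Ah)"
proof -
  interpret formal_integration I
    using assms by unfold_locales
  \<comment> \<open>By uniqueness every choice agrees with the given \<open>Ah\<close>; a source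
    without classical fields gets an arbitrary value, about which nothing is claimed.\<close>
  define A where "A K = (SOME Ah. \<exists>J Bh. classical_fields g J K Ah Bh)" for K
  let ?DD1 = "\<lambda>K. connected_diagrams (L_one_loop (A K))"
  \<comment> \<open>The factor is the inverse of \<open>\<i>\<close>, so that \<open>\<i>\<close>
    times \<open>W1\<close> is the sum over connected diagrams.\<close>
  let ?W1 = "\<lambda>K. fps_const (fps_const (- \<i>)) * diagram_sum I g (L_one_loop (A K)) (?DD1 K)"
  have W1: "fps_const (fps_const \<i>) * ?W1 K = diagram_sum I g (L_one_loop (A K)) (?DD1 K)" for K
    by (simp flip: mult.assoc)
  show ?thesis
  proof (intro exI[of _ ?DD1] exI[of _ ?W1] allI impI)
    fix J K Ah Bh assume fields: "classical_fields g J K Ah Bh"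
    then have "\<exists>J Bh. classical_fields g J K (A K) Bh"
      unfolding A_def by (intro someI[of "\<lambda>Ah. \<exists>J Bh. classical_fields g J K Ah Bh" Ah]) blast
    then have A: "A K = Ah"
      using classical_A_unique[OF _ fields] by blast
    let ?L1 = "L_one_loop Ah" and ?int = "L_TOT g - L_free g"
    have finite: "finite {w. ?L1 w \<noteq> 0}"
      using finite_support_one_loop by (simp add: finite_support_def)
    have even: "even_ghosts w" if "?L1 w \<noteq> 0" for w
      using supportedD[OF one_loop_vertices that] by simp
    have neutral: "supported ?L1 (\<lambda>w. word_charge w = 0)"
      using one_loop_vertices by (rule supported_weaken) simp
    have decomposition: "L_tilde g Ah Bh - L_free g = (?int + L_rest g Ah Bh) + ?L1"
      unfolding L_tilde_decomposition by (simp only: algebra_simps)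
    have charged: "supported (?int + L_rest g Ah Bh) (\<lambda>w. 0 < word_charge w)"
      by (intro supported_add interaction_charge rest_charge)
    have zero: "supported 0 (\<lambda>w. word_charge w = 0)"
      by (simp add: supported_def)
    \<comment> \<open>All vertices of the total action have positive charge, so its neutral part is
      0 and the denominator of both ratios is 1.\<close>
    have TOT: "path_integral I g (L_TOT g) = 1"
      using path_integral_add_neutral[OF _ interaction_charge zero, of "L_TOT g" g]
      by (simp add: diagram_sum_zero_density)
    have tilde: "path_integral I g (L_tilde g Ah Bh) = diagram_sum I g ?L1 (diagrams ?L1)"
      by (rule path_integral_add_neutral[OF decomposition charged neutral])
    have "path_integral I g (L_TOT g + ?L1) = diagram_sum I g ?L1 (diagrams ?L1)"
      by (rule path_integral_add_neutral[OF _ interaction_charge neutral]) (simp only: algebra_simps)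
    moreover have inverse_1: "inverse (1 :: pert_series) = 1"
      by (simp add: fps_inverse_one')
    ultimately have expectation: "expectation_exp I g ?L1 = diagram_sum I g ?L1 (diagrams ?L1)"
      by (simp add: expectation_exp_def TOT)
    have ratio: "vacuum_ratio I g Ah Bh = diagram_sum I g ?L1 (diagrams ?L1)"
      by (simp add: vacuum_ratio_def TOT tilde inverse_1)
    have connected_tilde: "connected_diagrams (L_tilde g Ah Bh - L_free g) n = connected_diagrams ?L1 n" for n
      unfolding decomposition connected_diagrams_def diagrams_add_neutral[OF charged neutral] ..
    have connected_TOT: "connected_diagrams ?int n = {}" for n
    proof -
      have "diagrams ?int n = diagrams 0 n"
        using diagrams_add_neutral[OF interaction_charge zero] by simp
      then show ?thesis
        by (auto simp: connected_diagrams_def connected_diagram_def diagrams_def)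
    qed
    have vacuum: "vacuum_connected_diagrams g Ah Bh = connected_diagrams ?L1"
      by (simp add: vacuum_connected_diagrams_def connected_tilde connected_TOT fun_eq_iff)
    \<comment> \<open>The vertices of these diagrams are neutral words, on which the full
      interaction and \<open>?L1\<close> have the same coefficients.\<close>
    have sum: "diagram_sum I g (L_tilde g Ah Bh - L_free g) (connected_diagrams ?L1) =
        diagram_sum I g ?L1 (connected_diagrams ?L1)"
      unfolding decomposition
    proof (rule diagram_sum_add_neutral[OF charged neutral])
      show "connected_diagrams ?L1 n \<subseteq> diagrams ?L1 n" for n
        by (auto simp: connected_diagrams_def)
    qed
    have linked: "pert_exp (diagram_sum I g ?L1 (connected_diagrams ?L1)) = diagram_sum I g ?L1 (diagrams ?L1)"
      "pert_ln (diagram_sum I g ?L1 (diagrams ?L1)) = diagram_sum I g ?L1 (connected_diagrams ?L1)"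
      using linked_cluster[OF finite] even by blast+
    show "(\<forall>n. vacuum_connected_diagrams g Ah Bh n = ?DD1 K n) \<and>
      (\<forall>n. ?DD1 K n = connected_diagrams ?L1 n) \<and>
      (\<forall>n. \<forall>D\<in>?DD1 K n. loop_number D = 1) \<and>
      diagram_sum I g (L_tilde g Ah Bh - L_free g) (vacuum_connected_diagrams g Ah Bh)
        = pert_ln (vacuum_ratio I g Ah Bh) \<and>
      pert_ln (vacuum_ratio I g Ah Bh) = fps_const (fps_const \<i>) * ?W1 K \<and>
      fps_const (fps_const \<i>) * ?W1 K = diagram_sum I g ?L1 (?DD1 K) \<and>
      pert_exp (fps_const (fps_const \<i>) * ?W1 K) = expectation_exp I g ?L1"
      unfolding A W1[of K, unfolded A] vacuum sum ratio expectation linked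
      using one_loop_number by (auto simp: connected_diagrams_def simp del: split_paired_All)
  qed
qed

end
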